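(* Let $M$ be a von Neumann algebra, and let $L$ be a locally compact Hausdorff space. Then every derivation on $C_0(L,M)$ is point-weak$^*$ continuous.
   Context: $C_0(L,M)$ is the C$^*$-algebra of all norm-continuous functions $L\to M$ vanishing at infinity, with pointwise operations and the supremum norm. A derivation on a C$^*$-algebra $B$ is a linear map $D:B\to B$ with $D(ab)=D(a)b+aD(b)$ for all $a,b\in B$. A net $(X_\lambda)$ in $C_0(L,M)$ converges to $X\in C_0(L,M)$ in the point-weak$^*$ topology if for each $t\in L$ the net $(X_\lambda(t))$ converges to $X(t)$ in the weak$^*$ topology of $M$. Point-weak$^*$ continuous means continuous from $C_0(L,M)$ to itself when both copies carry the point-weak$^*$ topology. *)

theory Defs
  imports "HOL-Analysis.Analysis"
begin

section \<open>Complex Hilbert spaces\<close>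

text \<open>
  The real structure (vector space, norm, topology) is the library's; the complex inner product
  is linear in its first argument, and the real inner product is its real part, so that
  \<open>norm x = sqrt (Re (cinner x x))\<close>.
\<close>

class chilbert_space = real_inner + complete_space +
  fixes scaleC :: "complex \<Rightarrow> 'a \<Rightarrow> 'a"  (infixr \<open>*\<^sub>C\<close> 75)
    and cinner :: "'a \<Rightarrow> 'a \<Rightarrow> complex"
  assumes scaleC_add_right: "c *\<^sub>C (x + y) = c *\<^sub>C x + c *\<^sub>C y"
    and scaleC_add_left: "(c + d) *\<^sub>C x = c *\<^sub>C x + d *\<^sub>C x"
    and scaleC_scaleC: "c *\<^sub>C (d *\<^sub>C x) = (c * d) *\<^sub>C x"
    and scaleC_of_real: "complex_of_real r *\<^sub>C x = r *\<^sub>R x"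
    and cinner_add_left: "cinner (x + y) z = cinner x z + cinner y z"
    and cinner_scaleC_left: "cinner (c *\<^sub>C x) y = c * cinner x y"
    and cinner_commute: "cinner y x = cnj (cinner x y)"
    and inner_eq_Re_cinner: "inner x y = Re (cinner x y)"
begin

lemma cinner_self: "cinner x x = complex_of_real (inner x x)"
proof -
  have "Im (cinner x x) = 0"
    using cinner_commute[of x x] by (metis add.inverse_neutral cnj.simps(2) equal_neg_zero)
  then show ?thesis
    by (simp add: complex_eq_iff inner_eq_Re_cinner)
qed

lemma norm_scaleC: "norm (c *\<^sub>C x) = cmod c * norm x"
proof -
  have "cinner (c *\<^sub>C x) (c *\<^sub>C x) = c * cnj c * cinner x x"
    by (metis cinner_commute cinner_scaleC_left complex_cnj_mult mult.assoc)
  also have "\<dots> = complex_of_real ((cmod c)\<^sup>2 * inner x x)"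
    by (simp only: cinner_self complex_norm_square of_real_mult)
  finally have "inner (c *\<^sub>C x) (c *\<^sub>C x) = (cmod c)\<^sup>2 * inner x x"
    by (simp only: cinner_self of_real_eq_iff)
  then show ?thesis
    by (simp add: norm_eq_sqrt_inner real_sqrt_mult)
qed

end

lemma bounded_linear_scaleC: "bounded_linear (\<lambda>x :: 'h :: chilbert_space. c *\<^sub>C x)"
proof (rule bounded_linear_intro[where K = "cmod c"])
  fix r :: real and x y :: 'h
  show "c *\<^sub>C (x + y) = c *\<^sub>C x + c *\<^sub>C y"
    by (rule scaleC_add_right)
  show "c *\<^sub>C (r *\<^sub>R x) = r *\<^sub>R (c *\<^sub>C x)"
    by (metis mult.commute scaleC_of_real scaleC_scaleC)
  show "norm (c *\<^sub>C x) \<le> norm x * cmod c"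
    by (simp add: norm_scaleC mult.commute)
qed


section \<open>Von Neumann algebras and their weak* topology\<close>

definition bounded_ops :: "('h :: chilbert_space \<Rightarrow>\<^sub>L 'h) set" where
  "bounded_ops = {T. \<forall>c x. blinfun_apply T (c *\<^sub>C x) = c *\<^sub>C blinfun_apply T x}"

lift_definition scaleC_op :: "complex \<Rightarrow> ('h :: chilbert_space \<Rightarrow>\<^sub>L 'h) \<Rightarrow> 'h \<Rightarrow>\<^sub>L 'h"
  is "\<lambda>c T x. c *\<^sub>C T x"
  by (rule bounded_linear_compose[OF bounded_linear_scaleC])

definition is_adjoint :: "('h :: chilbert_space \<Rightarrow>\<^sub>L 'h) \<Rightarrow> ('h \<Rightarrow>\<^sub>L 'h) \<Rightarrow> bool" where
  "is_adjoint T S \<longleftrightarrow> (\<forall>x y. cinner (blinfun_apply T x) y = cinner x (blinfun_apply S y))"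

definition commutant :: "('h :: chilbert_space \<Rightarrow>\<^sub>L 'h) set \<Rightarrow> ('h \<Rightarrow>\<^sub>L 'h) set" where
  "commutant M = {T \<in> bounded_ops. \<forall>S\<in>M. T o\<^sub>L S = S o\<^sub>L T}"

text \<open>
  A commutant is automatically a subalgebra of the bounded operators containing the identity, so
  the last condition also makes \<open>M\<close> a unital subalgebra.
\<close>

definition von_neumann_algebra :: "('h :: chilbert_space \<Rightarrow>\<^sub>L 'h) set \<Rightarrow> bool" where
  "von_neumann_algebra M \<longleftrightarrow>
     M \<subseteq> bounded_ops \<and>
     (\<forall>T\<in>M. \<exists>S\<in>M. is_adjoint T S) \<and>
     commutant (commutant M) = M"

text \<open>
  The predual of \<open>M\<close> consists of the restrictions to \<open>M\<close> of the functionals \<open>T \<mapsto> tr (T A)\<close> with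
  \<open>A\<close> of trace class. These are exactly the functionals below, with square-summable sequences of
  vectors; the weak* topology of \<open>M\<close> is the topology they induce (the sigma-weak topology).
\<close>

definition normal_functionals :: "(('h :: chilbert_space \<Rightarrow>\<^sub>L 'h) \<Rightarrow> complex) set" where
  "normal_functionals =
     {\<lambda>T. \<Sum>n. cinner (blinfun_apply T (x n)) (y n) | x y :: nat \<Rightarrow> 'h.
        summable (\<lambda>n. (norm (x n))\<^sup>2) \<and> summable (\<lambda>n. (norm (y n))\<^sup>2)}"

definition weak_star_topology ::
    "('h :: chilbert_space \<Rightarrow>\<^sub>L 'h) set \<Rightarrow> ('h \<Rightarrow>\<^sub>L 'h) topology" where
  "weak_star_topology M =
     topology_generated_by {{T \<in> M. \<phi> T \<in> U} | \<phi> U. \<phi> \<in> normal_functionals \<and> open U}"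

lemma topspace_weak_star_topology:
  fixes M :: "('h :: chilbert_space \<Rightarrow>\<^sub>L 'h) set"
  shows "topspace (weak_star_topology M) = M"
proof -
  have "(\<lambda>T :: 'h \<Rightarrow>\<^sub>L 'h. \<Sum>n::nat. cinner (blinfun_apply T 0) (0 :: 'h))
      \<in> normal_functionals"
    unfolding normal_functionals_def
    by (rule CollectI, rule exI[of _ "\<lambda>_. 0"], rule exI[of _ "\<lambda>_. 0"]) simp
  then obtain \<phi> :: "('h \<Rightarrow>\<^sub>L 'h) \<Rightarrow> complex" where "\<phi> \<in> normal_functionals"
    by blast
  then have "M \<in> {{T \<in> M. \<phi> T \<in> U} | \<phi> U. \<phi> \<in> normal_functionals \<and> open U}"
    by (intro CollectI exI[of _ \<phi>] exI[of _ UNIV]) auto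
  then show ?thesis
    unfolding weak_star_topology_def topology_generated_by_topspace by blast
qed


section \<open>The algebra of continuous functions vanishing at infinity\<close>

text \<open>
  Functions on \<open>L\<close> are represented by their extensional versions (value \<open>undefined\<close> off
  \<open>topspace L\<close>), so that equality of elements is equality on \<open>L\<close>. The topology on \<open>'h \<Rightarrow>\<^sub>L 'h\<close>
  used for continuity is the operator norm topology.
\<close>

definition C0 ::
    "'l topology \<Rightarrow> ('h :: chilbert_space \<Rightarrow>\<^sub>L 'h) set \<Rightarrow> ('l \<Rightarrow> 'h \<Rightarrow>\<^sub>L 'h) set" where
  "C0 L M =
     {X \<in> topspace L \<rightarrow>\<^sub>E M.
        continuous_map L euclidean X \<and>
        (\<forall>e>0. \<exists>K. compactin L K \<and> (\<forall>t \<in> topspace L - K. norm (X t) < e))}"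

definition C0_add ::
    "'l topology \<Rightarrow> ('l \<Rightarrow> 'h :: chilbert_space \<Rightarrow>\<^sub>L 'h) \<Rightarrow> ('l \<Rightarrow> 'h \<Rightarrow>\<^sub>L 'h) \<Rightarrow> 'l \<Rightarrow> 'h \<Rightarrow>\<^sub>L 'h" where
  "C0_add L X Y = (\<lambda>t\<in>topspace L. X t + Y t)"

definition C0_scale ::
    "'l topology \<Rightarrow> complex \<Rightarrow> ('l \<Rightarrow> 'h :: chilbert_space \<Rightarrow>\<^sub>L 'h) \<Rightarrow> 'l \<Rightarrow> 'h \<Rightarrow>\<^sub>L 'h" where
  "C0_scale L c X = (\<lambda>t\<in>topspace L. scaleC_op c (X t))"

definition C0_mult ::
    "'l topology \<Rightarrow> ('l \<Rightarrow> 'h :: chilbert_space \<Rightarrow>\<^sub>L 'h) \<Rightarrow> ('l \<Rightarrow> 'h \<Rightarrow>\<^sub>L 'h) \<Rightarrow> 'l \<Rightarrow> 'h \<Rightarrow>\<^sub>L 'h" where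
  "C0_mult L X Y = (\<lambda>t\<in>topspace L. X t o\<^sub>L Y t)"

definition C0_derivation ::
    "'l topology \<Rightarrow> ('h :: chilbert_space \<Rightarrow>\<^sub>L 'h) set \<Rightarrow>
     (('l \<Rightarrow> 'h \<Rightarrow>\<^sub>L 'h) \<Rightarrow> 'l \<Rightarrow> 'h \<Rightarrow>\<^sub>L 'h) \<Rightarrow> bool" where
  "C0_derivation L M D \<longleftrightarrow>
     D \<in> C0 L M \<rightarrow> C0 L M \<and>
     (\<forall>X\<in>C0 L M. \<forall>Y\<in>C0 L M. D (C0_add L X Y) = C0_add L (D X) (D Y)) \<and>
     (\<forall>c. \<forall>X\<in>C0 L M. D (C0_scale L c X) = C0_scale L c (D X)) \<and>
     (\<forall>X\<in>C0 L M. \<forall>Y\<in>C0 L M.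
        D (C0_mult L X Y) = C0_add L (C0_mult L (D X) Y) (C0_mult L X (D Y)))"

text \<open>The topology of pointwise convergence with respect to the weak* topology of \<open>M\<close>.\<close>

definition point_weak_star_topology ::
    "'l topology \<Rightarrow> ('h :: chilbert_space \<Rightarrow>\<^sub>L 'h) set \<Rightarrow> ('l \<Rightarrow> 'h \<Rightarrow>\<^sub>L 'h) topology" where
  "point_weak_star_topology L M =
     subtopology (product_topology (\<lambda>_. weak_star_topology M) (topspace L)) (C0 L M)"

lemma topspace_point_weak_star_topology: "topspace (point_weak_star_topology L M) = C0 L M"
  by (auto simp: point_weak_star_topology_def topspace_weak_star_topology C0_def)

text \<open>Convergence of nets in the sense of filters is pointwise weak* convergence.\<close>

lemma limitin_point_weak_star_topology:
  assumes "\<And>i. X i \<in> C0 L M" "Y \<in> C0 L M"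
  shows "limitin (point_weak_star_topology L M) X Y F \<longleftrightarrow>
    (\<forall>t\<in>topspace L. limitin (weak_star_topology M) (\<lambda>i. X i t) (Y t) F)"
proof -
  have "X i \<in> extensional (topspace L)" "X i \<in> topspace L \<rightarrow> M" for i
    using assms(1)[of i] by (auto simp: C0_def PiE_def)
  moreover have "Y \<in> extensional (topspace L)"
    using assms(2) by (auto simp: C0_def PiE_def)
  ultimately show ?thesis
    using assms
    by (auto simp: point_weak_star_topology_def limitin_subtopology limitin_componentwise
        topspace_weak_star_topology Pi_iff PiE_iff)
qed

end

theory Submission
  imports Defs
begin

text \<open>
  A derivation \<open>D\<close> of \<open>C\<^sub>0(L, M)\<close> is local: if \<open>X\<close> vanishes at \<open>t\<close> it is a product of two elements
  vanishing at \<open>t\<close>, so \<open>D X\<close> vanishes at \<open>t\<close>. Hence \<open>D X t = d (X t)\<close> for a derivation \<open>d\<close> of \<open>M\<close>,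
  and it remains to see that \<open>d\<close> is weak* continuous.

  The real and imaginary parts of \<open>d\<close> on the self-adjoint elements are dissipative, hence closable,
  hence bounded by the closed graph theorem. If \<open>u\<close> is unitary, the averages
  \<open>A = (1/N) \<Sum>n<N. d (u\<^sup>n) u\<^sup>-\<^sup>n\<close> satisfy \<open>\<parallel>A\<parallel> \<le> \<parallel>d\<parallel>\<close> and implement \<open>d\<close> on \<open>u\<close> and \<open>u\<^sup>*\<close> up to
  \<open>O(1/N)\<close>. A self-adjoint contraction \<open>a\<close> is a combination of such a pair, so
  \<open>\<bar>\<langle>d a x, y\<rangle>\<bar> \<le> \<parallel>d\<parallel> (\<parallel>a x\<parallel> \<parallel>y\<parallel> + \<parallel>x\<parallel> \<parallel>a y\<parallel>)\<close>. By the Riesz representation theorem on \<open>H \<times> H\<close>,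
  \<open>a \<mapsto> Re \<langle>d a x, y\<rangle>\<close> has the form \<open>Re \<langle>a x, v\<rangle> + Re \<langle>a y, w\<rangle>\<close> with bounds on \<open>v\<close> and \<open>w\<close> that
  persist under square-summable sums: precomposing a normal functional with \<open>d\<close> gives a
  combination of normal functionals.
\<close>

section \<open>Two facts from functional analysis\<close>

text \<open>HOL functions are total, whereas the maps below are meaningful only on a subspace of
  operators; linearity is therefore relative to \<open>S\<close>.\<close>

locale subspace_linear =
  fixes S :: "'a::real_vector set" and f :: "'a \<Rightarrow> 'b::real_vector"
  assumes sub: "subspace S"
    and add: "\<And>a b. a \<in> S \<Longrightarrow> b \<in> S \<Longrightarrow> f (a + b) = f a + f b"
    and scale: "\<And>r a. a \<in> S \<Longrightarrow> f (r *\<^sub>R a) = r *\<^sub>R f a"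
begin

lemma zero: "f 0 = 0"
  using scale[of 0 0] subspace_0[OF sub] by simp

lemma diff: "a \<in> S \<Longrightarrow> b \<in> S \<Longrightarrow> f (a - b) = f a - f b"
  using add[of a "(-1) *\<^sub>R b"] scale[of b "-1"] subspace_scale[OF sub, of b "-1"] by simp

end

text \<open>Minimise the square of \<open>norm (J s)\<close> minus \<open>2 * f s\<close> over
  \<open>S\<close>. A minimising sequence has Cauchy images under \<open>J\<close>, and their limit
  represents \<open>f\<close>. Keeping the parameter \<open>s\<close> avoids inverting
  \<open>J\<close> or closing up its range.\<close>

lemma riesz_parametrized:
  fixes J :: "'s::real_vector \<Rightarrow> 'e::{real_inner,complete_space}"
  assumes f: "subspace_linear S (f :: 's \<Rightarrow> real)" and J: "linear J"
    and bound: "\<And>s. s \<in> S \<Longrightarrow> \<bar>f s\<bar> \<le> C * norm (J s)" and "0 \<le> C"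
  shows "\<exists>w. (\<forall>s\<in>S. f s = J s \<bullet> w) \<and> norm w \<le> C"
proof -
  interpret f: subspace_linear S f by (rule f)
  define q where "q s = (norm (J s))\<^sup>2 - 2 * f s" for s
  define m where "m = Inf (q ` S)"
  have S0: "0 \<in> S" by (rule subspace_0[OF f.sub])
  have "q s \<ge> - C\<^sup>2" if "s \<in> S" for s
  proof -
    have "0 \<le> (norm (J s) - C)\<^sup>2" by simp
    then have "2 * (C * norm (J s)) \<le> (norm (J s))\<^sup>2 + C\<^sup>2"
      by (simp add: power2_diff algebra_simps)
    then show ?thesis using bound[OF that] unfolding q_def by linarith
  qed
  then have bdd: "bdd_below (q ` S)" by (auto intro!: bdd_belowI)
  then have m: "m \<le> q s" if "s \<in> S" for s
    unfolding m_def using that by (intro cInf_lower) auto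
  have "\<exists>s\<in>S. q s < m + inverse (Suc n)" for n
  proof -
    have "q ` S \<noteq> {}" using S0 by auto
    moreover have "Inf (q ` S) < m + inverse (Suc n)" by (simp add: m_def)
    ultimately show ?thesis using cInf_lessD[of "q ` S"] by blast
  qed
  then have "\<forall>n. \<exists>s. s \<in> S \<and> q s < m + inverse (Suc n)" by blast
  then obtain s where s: "\<And>n. s n \<in> S" "\<And>n. q (s n) < m + inverse (Suc n)"
    using choice[of "\<lambda>n s. s \<in> S \<and> q s < m + inverse (Suc n)"] by blast
  \<comment> \<open>Parallelogram law, with the minimality bound applied to the midpoint of
    \<open>a\<close> and \<open>b\<close>.\<close>
  have par: "(norm (J a - J b))\<^sup>2 \<le> 2 * (q a - m) + 2 * (q b - m)" if "a \<in> S" "b \<in> S" for a b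
  proof -
    define c where "c = (1/2) *\<^sub>R (a + b)"
    have c: "c \<in> S" using that f.sub by (simp add: c_def subspace_add subspace_scale)
    have "f c = (f a + f b) / 2"
      using that f.sub by (simp add: c_def f.scale f.add subspace_add)
    moreover have "J c = (1/2) *\<^sub>R (J a + J b)"
      by (simp add: c_def linear_scale[OF J] linear_add[OF J])
    moreover have "(norm (J a - J b))\<^sup>2 = 2 * (norm (J a))\<^sup>2 + 2 * (norm (J b))\<^sup>2 - (norm (J a + J b))\<^sup>2"
      unfolding power2_norm_eq_inner
      by (simp add: inner_add_left inner_add_right inner_diff_left inner_diff_right)
    ultimately have "(norm (J a - J b))\<^sup>2 = 2 * q a + 2 * q b - 4 * q c"
      by (simp add: q_def power_mult_distrib power_divide)
    with m[OF c] show ?thesis by simp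
  qed
  have "Cauchy (\<lambda>n. J (s n))"
  proof (rule CauchyI')
    fix e :: real assume e: "e > 0"
    obtain N where N: "inverse (Suc N) < e\<^sup>2 / 4"
      using reals_Archimedean[of "e\<^sup>2 / 4"] e by auto
    show "\<exists>M. \<forall>m\<ge>M. \<forall>n>m. dist (J (s m)) (J (s n)) < e"
    proof (intro exI allI impI)
      fix i j assume "N \<le> i" "i < j"
      have "inverse (Suc i) \<le> inverse (Suc N)" "inverse (Suc j) \<le> inverse (Suc N)"
        using \<open>N \<le> i\<close> \<open>i < j\<close> by (auto intro!: le_imp_inverse_le)
      then have "q (s i) - m < e\<^sup>2 / 4" "q (s j) - m < e\<^sup>2 / 4"
        using s(2)[of i] s(2)[of j] N by linarith+
      then have "(norm (J (s i) - J (s j)))\<^sup>2 < e\<^sup>2"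
        by (intro le_less_trans[OF par[OF s(1) s(1), of i j]]) simp
      then show "dist (J (s i)) (J (s j)) < e"
        using e by (simp add: dist_norm power_less_imp_less_base)
    qed
  qed
  then obtain w where w: "(\<lambda>n. J (s n)) \<longlonglongrightarrow> w"
    using Cauchy_convergent_iff convergent_def by blast
  have expand: "(norm (a + t *\<^sub>R b))\<^sup>2 = (norm a)\<^sup>2 + 2 * t * (a \<bullet> b) + t\<^sup>2 * (norm b)\<^sup>2"
    for a b :: 'e and t
    unfolding power2_norm_eq_inner
    by (simp add: inner_add_left inner_add_right inner_commute[of b a] power2_eq_square distrib_left)
  have fw: "f v = J v \<bullet> w" if v: "v \<in> S" for v
  proof -
    \<comment> \<open>First variation: compare the infimum with the value of \<open>q\<close> at
      \<open>s n + t *\<^sub>R v\<close>, then let \<open>n\<close> tend to infinity.\<close>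
    have key: "0 \<le> 2 * t * (w \<bullet> J v - f v) + t\<^sup>2 * (norm (J v))\<^sup>2" for t
    proof -
      have *: "- inverse (Suc n) \<le> 2 * t * (J (s n) \<bullet> J v - f v) + t\<^sup>2 * (norm (J v))\<^sup>2" for n
      proof -
        have "s n + t *\<^sub>R v \<in> S" using v s(1) f.sub by (simp add: subspace_add subspace_scale)
        then have "m \<le> q (s n + t *\<^sub>R v)" by (rule m)
        also have "\<dots> = q (s n) + 2 * t * (J (s n) \<bullet> J v - f v) + t\<^sup>2 * (norm (J v))\<^sup>2"
          using v s(1)[of n] f.sub
          by (simp add: q_def f.add f.scale subspace_scale linear_add[OF J] linear_scale[OF J]
              expand right_diff_distrib)
        finally show ?thesis using s(2)[of n] by linarith
      qed
      have "(\<lambda>n. - inverse (real (Suc n))) \<longlonglongrightarrow> - 0"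
        by (intro tendsto_minus LIMSEQ_inverse_real_of_nat)
      moreover have "(\<lambda>n. 2 * t * (J (s n) \<bullet> J v - f v) + t\<^sup>2 * (norm (J v))\<^sup>2)
          \<longlonglongrightarrow> 2 * t * (w \<bullet> J v - f v) + t\<^sup>2 * (norm (J v))\<^sup>2"
        by (intro tendsto_intros w)
      ultimately have "- 0 \<le> 2 * t * (w \<bullet> J v - f v) + t\<^sup>2 * (norm (J v))\<^sup>2"
        by (rule LIMSEQ_le) (use * in blast)
      then show ?thesis by simp
    qed
    have "w \<bullet> J v - f v = 0"
    proof (rule ccontr)
      define d where "d = w \<bullet> J v - f v"
      \<comment> \<open>Adding 1 keeps the denominator positive even if \<open>J v = 0\<close>; at
        \<open>t = - d / p\<close> the quadratic in \<open>key\<close> would be negative.\<close>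
      define p where "p = (norm (J v))\<^sup>2 + 1"
      assume "w \<bullet> J v - f v \<noteq> 0"
      then have "d\<^sup>2 > 0" by (simp add: d_def)
      have p: "p > 0" by (simp add: p_def add_nonneg_pos)
      have "0 \<le> 2 * (- d / p) * d + (- d / p)\<^sup>2 * (p - 1)"
        using key[of "- d / p"] by (simp add: d_def p_def)
      also have "\<dots> = - d\<^sup>2 / p - d\<^sup>2 / p\<^sup>2"
        using p by (simp add: divide_simps) (simp add: power2_eq_square algebra_simps)
      also have "\<dots> < 0" using divide_pos_pos[OF \<open>d\<^sup>2 > 0\<close> p] divide_nonneg_nonneg[OF zero_le_power2[of d] zero_le_power2[of p]] by linarith
      finally show False by simp
    qed
    then show ?thesis by (simp add: inner_commute)
  qed
  have "norm w * norm w \<le> C * norm w"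
  proof -
    have "(\<lambda>n. J (s n) \<bullet> w) \<longlonglongrightarrow> w \<bullet> w" "(\<lambda>n. C * norm (J (s n))) \<longlonglongrightarrow> C * norm w"
      by (intro tendsto_intros w)+
    moreover have "J (s n) \<bullet> w \<le> C * norm (J (s n))" for n
      using bound[OF s(1), of n] fw[OF s(1), of n] by simp
    ultimately have "w \<bullet> w \<le> C * norm w" by (intro LIMSEQ_le) auto
    then show ?thesis by (simp add: dot_square_norm power2_eq_square)
  qed
  then have "norm w \<le> C" using \<open>0 \<le> C\<close> by (cases "norm w = 0") auto
  with fw show ?thesis by blast
qed

text \<open>Baire's theorem puts a ball of \<open>S\<close> inside the closure of a sublevel set of
  \<open>norm (f a)\<close>, so elements can be approximated with controlled image. Iterating on the
  remainders gives a series, and closability identifies its sum with \<open>f a\<close>.\<close>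

lemma closed_graph_bounded:
  fixes S :: "'a::banach set" and f :: "'a \<Rightarrow> 'b::banach"
  assumes f: "subspace_linear S f" and "closed S"
    and closable: "\<And>a b. (\<And>n. a n \<in> S) \<Longrightarrow> a \<longlonglongrightarrow> 0 \<Longrightarrow> (\<lambda>n. f (a n)) \<longlonglongrightarrow> b \<Longrightarrow> b = 0"
  shows "\<exists>K\<ge>0. \<forall>a\<in>S. norm (f a) \<le> K * norm a"
proof -
  interpret f: subspace_linear S f by (rule f)
  define C where "C n = {a \<in> S. norm (f a) \<le> real n}" for n :: nat
  have "completely_metrizable_space (top_of_set S)"
    using \<open>closed S\<close> by (metis closed_closedin completely_metrizable_space_closedin completely_metrizable_space_euclidean)
  have "S \<noteq> {}" using subspace_0[OF f.sub] by auto
  have "\<exists>n. top_of_set S interior_of (S \<inter> closure (C n)) \<noteq> {}"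
  proof (rule ccontr)
    assume "\<not> ?thesis"
    moreover have "closedin (top_of_set S) (S \<inter> closure (C n))" for n
      by (simp add: closedin_closed_Int)
    ultimately have "top_of_set S interior_of \<Union>(range (\<lambda>n. S \<inter> closure (C n))) = {}"
      by (intro Baire_category_alt disjI1 \<open>completely_metrizable_space (top_of_set S)\<close>) auto
    moreover have "\<Union>(range (\<lambda>n. S \<inter> closure (C n))) = S"
    proof -
      have "\<exists>n. a \<in> C n" if "a \<in> S" for a
        using that real_arch_simple[of "norm (f a)"] by (auto simp: C_def)
      then show ?thesis using closure_subset by fastforce
    qed
    ultimately show False using \<open>S \<noteq> {}\<close> by (metis interior_of_topspace topspace_euclidean_subtopology)
  qed
  then obtain n U x where U: "openin (top_of_set S) U" "x \<in> U" "U \<subseteq> closure (C n)"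
    unfolding interior_of_def by auto
  then obtain r where r: "r > 0" "\<And>y. y \<in> S \<Longrightarrow> dist y x < r \<Longrightarrow> y \<in> closure (C n)" and x: "x \<in> S"
    unfolding openin_euclidean_subtopology_iff by (meson subset_iff)
  define k where "k = 4 * real n / r"
  have k0: "k \<ge> 0" using r by (simp add: k_def)
  have approx: "\<exists>c\<in>S. norm (f c) \<le> k * norm a \<and> norm (a - c) < e" if a: "a \<in> S" and e: "e > 0" for a e
  proof (cases "a = 0")
    case True
    then show ?thesis using subspace_0[OF f.sub] e by (intro bexI[of _ 0]) (auto simp: f.zero)
  next
    case False
    \<comment> \<open>Rescale \<open>a\<close> to length \<open>r / 2\<close>, approximate
      \<open>x + l *\<^sub>R a\<close> and \<open>x\<close> from \<open>C n\<close>, and divide the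
      difference by \<open>l\<close>; this is the origin of the constant \<open>k\<close>.\<close>
    define l where "l = r / (2 * norm a)"
    have l: "l > 0" using r False by (simp add: l_def)
    have la: "l *\<^sub>R a \<in> S" using a f.sub by (simp add: subspace_scale)
    have "norm (l *\<^sub>R a) < r" using r False by (simp add: l_def)
    then have "x + l *\<^sub>R a \<in> closure (C n)" "x \<in> closure (C n)"
      using r x la f.sub by (auto simp: dist_norm subspace_add)
    moreover have "l * e / 2 > 0" using l e by simp
    ultimately obtain b c where b: "b \<in> C n" "dist b (x + l *\<^sub>R a) < l * e / 2"
      and c: "c \<in> C n" "dist c x < l * e / 2"
      unfolding closure_approachable by blast
    define z where "z = inverse l *\<^sub>R (b - c)"
    have "b - c \<in> S" using b c f.sub by (simp add: C_def subspace_diff)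
    then have "z \<in> S" using f.sub by (simp add: z_def subspace_scale)
    moreover have "norm (f z) \<le> k * norm a"
    proof -
      have "norm (f (b - c)) \<le> 2 * n"
        using b(1) c(1) norm_triangle_ineq4[of "f b" "f c"] by (auto simp: C_def f.diff)
      then have "norm (f z) \<le> inverse l * (2 * n)"
        using l \<open>b - c \<in> S\<close> by (simp add: z_def f.scale mult_left_mono)
      also have "\<dots> = k * norm a" using r False by (simp add: k_def l_def field_simps)
      finally show ?thesis .
    qed
    moreover have "norm (a - z) < e"
    proof -
      have "l *\<^sub>R (a - z) = (c - x) - (b - (x + l *\<^sub>R a))"
        using l by (simp add: z_def algebra_simps)
      then have "l * norm (a - z) = norm ((c - x) - (b - (x + l *\<^sub>R a)))"
        using l by (metis abs_of_pos norm_scaleR)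
      also have "\<dots> < l * e"
        using b(2) c(2) norm_triangle_ineq4[of "c - x" "b - (x + l *\<^sub>R a)"] by (simp add: dist_norm)
      finally show ?thesis using l by simp
    qed
    ultimately show ?thesis by blast
  qed
  have "norm (f a) \<le> 2 * k * norm a" if a: "a \<in> S" for a
  proof -
    define N where "N = norm a"
    \<comment> \<open>\<open>T i\<close> is the remainder after \<open>i\<close> approximations, its
      norm bound halving each time. The clause for \<open>i = 0\<close> fixes the start
      \<open>T 0 = a\<close> under dependent choice.\<close>
    have "\<exists>T. \<forall>i. (T i \<in> S \<and> norm (T i) \<le> N / 2 ^ i \<and> (i = 0 \<longrightarrow> T i = a))
      \<and> norm (f (T i - T (Suc i))) \<le> k * norm (T i)"
    proof (rule dependent_nat_choice)
      show "\<exists>t. t \<in> S \<and> norm t \<le> N / 2 ^ 0 \<and> (0 = (0::nat) \<longrightarrow> t = a)" using a by (simp add: N_def)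
    next
      fix t i assume t: "t \<in> S \<and> norm t \<le> N / 2 ^ i \<and> (i = 0 \<longrightarrow> t = a)"
      show "\<exists>y. (y \<in> S \<and> norm y \<le> N / 2 ^ Suc i \<and> (Suc i = 0 \<longrightarrow> y = a)) \<and> norm (f (t - y)) \<le> k * norm t"
      proof (cases "N = 0")
        case True
        then have "t = 0" using t by simp
        then show ?thesis using True subspace_0[OF f.sub] by (intro exI[of _ 0]) (auto simp: f.zero)
      next
        case False
        then have "N / 2 ^ Suc i > 0" by (simp add: N_def)
        then obtain c where "c \<in> S" "norm (f c) \<le> k * norm t" "norm (t - c) < N / 2 ^ Suc i"
          using approx t by blast
        then show ?thesis using t f.sub by (intro exI[of _ "t - c"]) (auto simp: subspace_diff)
      qed
    qed
    then obtain T where T: "\<And>i. T i \<in> S" "\<And>i. norm (T i) \<le> N / 2 ^ i" "T 0 = a"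
      "\<And>i. norm (f (T i - T (Suc i))) \<le> k * norm (T i)" by metis
    define g where "g i = f (T i - T (Suc i))" for i
    have g: "norm (g i) \<le> k * N * (1/2) ^ i" for i
      using order_trans[OF T(4)[of i] mult_left_mono[OF T(2)[of i] k0]]
      by (simp add: g_def power_divide)
    have half: "(\<lambda>i. k * N * (1/2) ^ i) sums (k * N * 2)"
      using geometric_sums[of "1/2 :: real"] by (intro sums_mult) simp
    have sumg: "summable (\<lambda>i. norm (g i))"
      by (rule summable_comparison_test[OF _ sums_summable[OF half]]) (use g in auto)
    have "(\<Sum>i<n. g i) = f a - f (T n)" for n
      by (induction n) (auto simp: T(3) g_def f.diff[OF T(1) T(1)])
    then have ft: "f (T n) = f a - (\<Sum>i<n. g i)" for n by simp
    have "(\<lambda>n. f (T n)) \<longlonglongrightarrow> f a - suminf g"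
      unfolding ft by (intro tendsto_intros summable_LIMSEQ summable_norm_cancel[OF sumg])
    moreover have "T \<longlonglongrightarrow> 0"
    proof (rule Lim_null_comparison)
      show "\<forall>\<^sub>F i in sequentially. norm (T i) \<le> N * (1/2) ^ i"
        using T(2) by (simp add: power_one_over field_simps)
      show "(\<lambda>i. N * (1/2) ^ i) \<longlonglongrightarrow> 0"
        by (rule tendsto_mult_right_zero) (simp add: LIMSEQ_power_zero)
    qed
    \<comment> \<open>The remainders tend to 0 while their images converge to the defect of the
      series, so closability makes the defect 0.\<close>
    ultimately have "f a = suminf g" using closable[of T "f a - suminf g"] T(1) by simp
    then have "norm (f a) \<le> (\<Sum>i. norm (g i))" using summable_norm[OF sumg] by simp
    also have "\<dots> \<le> k * N * 2" using sums_le[OF g summable_sums[OF sumg] half] .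
    finally show ?thesis by (simp add: N_def)
  qed
  then show ?thesis using k0 by (intro exI[of _ "2 * k"]) auto
qed

section \<open>Jordan algebras of symmetric operators\<close>

lemma blinfun_compose_add_left: "(a + b) o\<^sub>L c = (a o\<^sub>L c) + (b o\<^sub>L c)"
  by (rule bounded_bilinear.add_left[OF bounded_bilinear_blinfun_compose])

lemma blinfun_compose_add_right: "a o\<^sub>L (b + c) = (a o\<^sub>L b) + (a o\<^sub>L c)"
  by (rule bounded_bilinear.add_right[OF bounded_bilinear_blinfun_compose])

lemma blinfun_compose_diff_left: "(a - b) o\<^sub>L c = (a o\<^sub>L c) - (b o\<^sub>L c)"
  by (rule bounded_bilinear.diff_left[OF bounded_bilinear_blinfun_compose])

lemma blinfun_compose_diff_right: "a o\<^sub>L (b - c) = (a o\<^sub>L b) - (a o\<^sub>L c)"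
  by (rule bounded_bilinear.diff_right[OF bounded_bilinear_blinfun_compose])

lemma blinfun_compose_scaleR_left: "(r *\<^sub>R a) o\<^sub>L c = r *\<^sub>R (a o\<^sub>L c)"
  by (rule bounded_bilinear.scaleR_left[OF bounded_bilinear_blinfun_compose])

lemma blinfun_compose_scaleR_right: "a o\<^sub>L (r *\<^sub>R c) = r *\<^sub>R (a o\<^sub>L c)"
  by (rule bounded_bilinear.scaleR_right[OF bounded_bilinear_blinfun_compose])

lemmas blinfun_compose_linear =
  blinfun_compose_add_left blinfun_compose_add_right blinfun_compose_diff_left
  blinfun_compose_diff_right blinfun_compose_scaleR_left blinfun_compose_scaleR_right

lemma blinfun_compose_assoc: "(a o\<^sub>L b) o\<^sub>L c = a o\<^sub>L (b o\<^sub>L c)"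
  by (rule blinfun_eqI) simp

lemma blinfun_compose_id [simp]: "a o\<^sub>L id_blinfun = a" "id_blinfun o\<^sub>L a = a"
  by (auto intro: blinfun_eqI)

lemmas tendsto_blinfun_compose = bounded_bilinear.tendsto[OF bounded_bilinear_blinfun_compose]

instance chilbert_space \<subseteq> banach ..

text \<open>Abstracts the self-adjoint part of an operator algebra: products of symmetric operators
  need not be symmetric, but squares are.\<close>

locale symmetric_jordan_algebra =
  fixes S :: "('h::{real_inner,banach} \<Rightarrow>\<^sub>L 'h) set"
  assumes sub: "subspace S"
    and closed: "closed S"
    and one: "id_blinfun \<in> S"
    and square: "\<And>a. a \<in> S \<Longrightarrow> a o\<^sub>L a \<in> S"
    and symmetric: "\<And>a x y. a \<in> S \<Longrightarrow> a x \<bullet> y = x \<bullet> a y"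
begin

text \<open>
  With \<open>c = 1 - y\<close> the equation \<open>c\<^sup>2 = 1 - x\<close> becomes \<open>y = (x + y\<^sup>2) / 2\<close>; the fixed point
  iteration from \<open>0\<close> is dominated, increments included, by the scalar one with \<open>x = 1\<close>.
\<close>

lemma sqrt_one_minus:
  assumes x: "x \<in> S" "norm x \<le> 1"
  shows "\<exists>c\<in>S. c o\<^sub>L c = id_blinfun - x \<and> (\<forall>b. b o\<^sub>L x = x o\<^sub>L b \<longrightarrow> b o\<^sub>L c = c o\<^sub>L b)"
proof -
  define y where "y = rec_nat 0 (\<lambda>n y. (1/2) *\<^sub>R (x + (y o\<^sub>L y)))"
  have y0: "y 0 = 0" and ySuc: "\<And>n. y (Suc n) = (1/2) *\<^sub>R (x + (y n o\<^sub>L y n))"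
    by (simp_all add: y_def)
  define s :: "nat \<Rightarrow> real" where "s = rec_nat 0 (\<lambda>n s. (1 + s\<^sup>2) / 2)"
  have s0: "s 0 = 0" and sSuc: "\<And>n. s (Suc n) = (1 + (s n)\<^sup>2) / 2"
    by (simp_all add: s_def)
  have s_bounds: "0 \<le> s n" "s n \<le> 1" for n
  proof -
    have "0 \<le> s n \<and> s n \<le> 1"
      by (induction n) (auto simp: s0 sSuc add_nonneg_nonneg power_le_one)
    then show "0 \<le> s n" "s n \<le> 1" by auto
  qed
  have s_mono: "s n \<le> s (Suc n)" for n
  proof -
    have "0 \<le> (1 - s n)\<^sup>2" by simp
    then show ?thesis by (simp add: sSuc power2_diff)
  qed
  have y_in: "y n \<in> S" for n
    by (induction n) (auto simp: y0 ySuc subspace_0[OF sub] intro!: subspace_scale[OF sub] subspace_add[OF sub] x square)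
  \<comment> \<open>Each iterate is a polynomial in \<open>x\<close>, so it commutes with whatever
    commutes with \<open>x\<close>; in particular the iterates commute with each other.\<close>
  have comm: "b o\<^sub>L y n = y n o\<^sub>L b" if b: "b o\<^sub>L x = x o\<^sub>L b" for b n
  proof (induction n)
    case (Suc n)
    have "b o\<^sub>L (y n o\<^sub>L y n) = (y n o\<^sub>L y n) o\<^sub>L b"
      using Suc by (metis blinfun_compose_assoc)
    then show ?case using b by (simp add: ySuc blinfun_compose_linear)
  qed (simp add: y0)
  have y_comm: "y m o\<^sub>L y n = y n o\<^sub>L y m" for m n
    by (intro comm comm[symmetric]) simp
  have norm_y: "norm (y n) \<le> s n" for n
  proof (induction n)
    case (Suc n)
    have "norm (y n o\<^sub>L y n) \<le> (s n)\<^sup>2"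
      using norm_blinfun_compose[of "y n" "y n"] mult_mono[OF Suc Suc] s_bounds
      by (simp add: power2_eq_square)
    then have "norm (x + (y n o\<^sub>L y n)) \<le> 1 + (s n)\<^sup>2"
      using x by (intro order_trans[OF norm_triangle_ineq]) simp
    then show ?case by (simp add: ySuc sSuc)
  qed (simp add: y0 s0)
  have norm_step: "norm (y (Suc n) - y n) \<le> s (Suc n) - s n" for n
  proof (induction n)
    case 0
    then show ?case using x by (simp add: ySuc y0 s0 sSuc)
  next
    case (Suc n)
    \<comment> \<open>Difference of squares, available since the iterates commute; the scalar
      increments factor in the same way.\<close>
    have "y (Suc (Suc n)) - y (Suc n) = (1/2) *\<^sub>R ((y (Suc n) - y n) o\<^sub>L (y (Suc n) + y n))"
      unfolding ySuc[of "Suc n"] ySuc[of n, symmetric]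
      using y_comm[of "Suc n" n]
      by (subst (2) ySuc) (simp add: blinfun_compose_linear algebra_simps)
    moreover have "norm ((y (Suc n) - y n) o\<^sub>L (y (Suc n) + y n)) \<le> (s (Suc n) - s n) * (s (Suc n) + s n)"
      by (rule order_trans[OF norm_blinfun_compose], rule mult_mono)
        (use Suc norm_triangle_le[OF add_mono[OF norm_y norm_y]] s_mono in auto)
    moreover have "(s (Suc n) - s n) * (s (Suc n) + s n) / 2 = s (Suc (Suc n)) - s (Suc n)"
    proof -
      have "s (Suc (Suc n)) - s (Suc n) = (1 + (s (Suc n))\<^sup>2) / 2 - (1 + (s n)\<^sup>2) / 2"
        by (rule arg_cong2[where f = minus, OF sSuc sSuc])
      also have "\<dots> = ((s (Suc n))\<^sup>2 - (s n)\<^sup>2) / 2"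
        by (simp add: add_divide_distrib diff_divide_distrib)
      finally show ?thesis by (simp add: power2_eq_square square_diff_square_factored mult.commute)
    qed
    ultimately show ?case by simp
  qed
  \<comment> \<open>Being monotone and bounded, \<open>s\<close> has summable increments, which
    dominate those of \<open>y\<close>.\<close>
  have "convergent s"
    by (rule Bseq_mono_convergent) (auto intro!: BseqI'[of _ 1] simp: s_bounds intro: lift_Suc_mono_le s_mono)
  then have "summable (\<lambda>n. s (Suc n) - s n)"
    by (metis convergentD telescope_summable)
  then have "summable (\<lambda>n. y (Suc n) - y n)"
    by (rule summable_comparison_test'[OF _ norm_step])
  then have "(\<lambda>n. \<Sum>i<n. y (Suc i) - y i) \<longlonglongrightarrow> (\<Sum>i. y (Suc i) - y i)" (is "_ \<longlonglongrightarrow> ?l")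
    by (rule summable_LIMSEQ)
  then obtain l where l: "y \<longlonglongrightarrow> l"
    by (auto simp: sum_lessThan_telescope y0)
  have "l \<in> S" using closed_sequentially[OF closed _ l] y_in by blast
  have l_eq: "l = (1/2) *\<^sub>R (x + (l o\<^sub>L l))"
  proof (rule LIMSEQ_unique)
    show "(\<lambda>n. y (Suc n)) \<longlonglongrightarrow> l" using l by (rule LIMSEQ_Suc)
    show "(\<lambda>n. y (Suc n)) \<longlonglongrightarrow> (1/2) *\<^sub>R (x + (l o\<^sub>L l))"
      unfolding ySuc by (intro tendsto_intros tendsto_blinfun_compose l)
  qed
  have l_comm: "b o\<^sub>L l = l o\<^sub>L b" if b: "b o\<^sub>L x = x o\<^sub>L b" for b
  proof (rule LIMSEQ_unique)
    show "(\<lambda>n. b o\<^sub>L y n) \<longlonglongrightarrow> (b o\<^sub>L l)" by (intro tendsto_blinfun_compose l tendsto_const)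
    show "(\<lambda>n. b o\<^sub>L y n) \<longlonglongrightarrow> (l o\<^sub>L b)"
      unfolding comm[OF b] by (intro tendsto_blinfun_compose l tendsto_const)
  qed
  show ?thesis
  proof (intro bexI conjI allI impI)
    show "id_blinfun - l \<in> S" by (rule subspace_diff[OF sub one \<open>l \<in> S\<close>])
    have "2 *\<^sub>R l = x + (l o\<^sub>L l)" by (subst l_eq) simp
    then have "l o\<^sub>L l = l + l - x" by (simp add: scaleR_2)
    then show "(id_blinfun - l) o\<^sub>L (id_blinfun - l) = id_blinfun - x"
      by (simp add: blinfun_compose_linear)
    show "b o\<^sub>L (id_blinfun - l) = (id_blinfun - l) o\<^sub>L b" if "b o\<^sub>L x = x o\<^sub>L b" for b
      using l_comm[OF that] by (simp add: blinfun_compose_linear)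
  qed
qed

text \<open>Rescale to \<open>x = (1/r) *\<^sub>R a\<close> and apply the previous root to
  \<open>x o\<^sub>L x\<close>; if \<open>r = 0\<close> then \<open>a = 0\<close>. That
  \<open>c\<close> commutes with \<open>a\<close> later makes \<open>c\<close> plus
  \<open>\<i>\<close> times \<open>a\<close> unitary.\<close>

lemma sqrt_norm_minus_square:
  assumes a: "a \<in> S" "norm a \<le> r"
  shows "\<exists>c\<in>S. c o\<^sub>L c = r\<^sup>2 *\<^sub>R id_blinfun - (a o\<^sub>L a)
    \<and> (\<forall>b. b o\<^sub>L a = a o\<^sub>L b \<longrightarrow> b o\<^sub>L c = c o\<^sub>L b)"
proof (cases "r = 0")
  case True
  then show ?thesis using a subspace_0[OF sub] by (intro bexI[of _ 0]) auto
next
  case False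
  then have r: "r > 0" using a norm_ge_zero[of a] by linarith
  define x where "x = (1/r) *\<^sub>R a"
  have x: "x \<in> S" unfolding x_def by (rule subspace_scale[OF sub a(1)])
  have nx: "norm x \<le> 1" using r a by (simp add: x_def)
  have "norm (x o\<^sub>L x) \<le> 1"
    using norm_blinfun_compose[of x x] mult_le_one[OF nx _ nx] by simp
  then obtain c where c: "c \<in> S" "c o\<^sub>L c = id_blinfun - (x o\<^sub>L x)"
    "\<And>b. b o\<^sub>L (x o\<^sub>L x) = (x o\<^sub>L x) o\<^sub>L b \<Longrightarrow> b o\<^sub>L c = c o\<^sub>L b"
    using sqrt_one_minus[OF square[OF x]] by blast
  show ?thesis
  proof (intro bexI conjI allI impI)
    show "r *\<^sub>R c \<in> S" by (rule subspace_scale[OF sub c(1)])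
    show "(r *\<^sub>R c) o\<^sub>L (r *\<^sub>R c) = r\<^sup>2 *\<^sub>R id_blinfun - (a o\<^sub>L a)"
      using r by (simp add: blinfun_compose_linear c(2) x_def scaleR_diff_right power2_eq_square)
    fix b assume "b o\<^sub>L a = a o\<^sub>L b"
    then have "b o\<^sub>L (a o\<^sub>L a) = (a o\<^sub>L a) o\<^sub>L b" by (metis blinfun_compose_assoc)
    then have "b o\<^sub>L (x o\<^sub>L x) = (x o\<^sub>L x) o\<^sub>L b"
      by (simp add: x_def blinfun_compose_linear)
    then show "b o\<^sub>L (r *\<^sub>R c) = (r *\<^sub>R c) o\<^sub>L b"
      using c(3) by (simp add: blinfun_compose_linear)
  qed
qed

end

text \<open>The Leibniz rule is stated for squares only, because \<open>S\<close> is closed under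
  squares but not in general under products.\<close>

locale jordan_derivation = symmetric_jordan_algebra S + subspace_linear S d
  for S :: "('h::{real_inner,banach} \<Rightarrow>\<^sub>L 'h) set" and d :: "('h \<Rightarrow>\<^sub>L 'h) \<Rightarrow> ('h \<Rightarrow>\<^sub>L 'h)" +
  assumes into: "\<And>a. a \<in> S \<Longrightarrow> d a \<in> S"
    and jordan: "\<And>a. a \<in> S \<Longrightarrow> d (a o\<^sub>L a) = (d a o\<^sub>L a) + (a o\<^sub>L d a)"
begin

lemma one_zero: "d id_blinfun = 0"
  using jordan[OF one] by simp

text \<open>
  If \<open>x\<close> is a unit vector with \<open>\<parallel>a x\<parallel>\<close> close to \<open>\<parallel>a\<parallel>\<close> and \<open>c\<^sup>2 = \<parallel>a\<parallel>\<^sup>2 - a\<^sup>2\<close>, then \<open>c x\<close> is small, so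
  \<open>-2 \<langle>d a x, a x\<rangle> = \<langle>d (c\<^sup>2) x, x\<rangle> = 2 \<langle>d c x, c x\<rangle>\<close> is small as well.
\<close>

lemma dissipative:
  assumes a: "a \<in> S"
  shows "norm a \<le> norm (a + d a)"
proof (rule ccontr)
  assume "\<not> ?thesis"
  define m s where "m = norm a" and "s = norm (a + d a)"
  then have sm: "0 \<le> s" "s < m" using \<open>\<not> norm a \<le> norm (a + d a)\<close> by auto
  obtain c where c: "c \<in> S" "c o\<^sub>L c = m\<^sup>2 *\<^sub>R id_blinfun - (a o\<^sub>L a)"
    using sqrt_norm_minus_square[OF a, of m] by (auto simp: m_def)
  define k where "k = 2 * norm (d c)"
  have k: "0 \<le> k" by (simp add: k_def)
  have da: "d a \<in> S" and dc: "d c \<in> S" using a c by (auto intro: into)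
  have "m\<^sup>2 *\<^sub>R id_blinfun \<in> S" by (rule subspace_scale[OF sub one])
  then have "d (c o\<^sub>L c) = - (d a o\<^sub>L a) - (a o\<^sub>L d a)"
    unfolding c(2) using square[OF a] by (simp add: diff scale[OF one] one_zero jordan[OF a])
  then have dcc: "(d c o\<^sub>L c) + (c o\<^sub>L d c) = - (d a o\<^sub>L a) - (a o\<^sub>L d a)"
    using jordan[OF c(1)] by simp
  have cross: "- (d a x \<bullet> a x) = d c x \<bullet> c x" for x
  proof -
    have "((d c o\<^sub>L c) + (c o\<^sub>L d c)) x \<bullet> x = (- (d a o\<^sub>L a) - (a o\<^sub>L d a)) x \<bullet> x"
      by (simp only: dcc)
    then have "d c (c x) \<bullet> x + c (d c x) \<bullet> x = - (d a (a x) \<bullet> x) - a (d a x) \<bullet> x"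
      by (simp add: blinfun.add_left blinfun.diff_left blinfun.minus_left inner_simps)
    moreover have "d c (c x) \<bullet> x = d c x \<bullet> c x" "c (d c x) \<bullet> x = d c x \<bullet> c x"
      "d a (a x) \<bullet> x = d a x \<bullet> a x" "a (d a x) \<bullet> x = d a x \<bullet> a x"
      using symmetric[OF dc, of "c x" x] symmetric[OF c(1), of "d c x" x]
        symmetric[OF da, of "a x" x] symmetric[OF a, of "d a x" x]
      by (simp_all add: inner_commute[of "a x"] inner_commute[of "c x"])
    ultimately show ?thesis by simp
  qed
  have ncx: "(norm (c x))\<^sup>2 = m\<^sup>2 * (norm x)\<^sup>2 - (norm (a x))\<^sup>2" for x
  proof -
    have "(c o\<^sub>L c) x \<bullet> x = (m\<^sup>2 *\<^sub>R id_blinfun - (a o\<^sub>L a)) x \<bullet> x"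
      by (simp only: c(2))
    then show ?thesis
      by (simp add: symmetric[OF a] symmetric[OF c(1)] blinfun.diff_left blinfun.scaleR_left
          inner_simps power2_norm_eq_inner)
  qed
  \<comment> \<open>If \<open>h = norm (c x)\<close> were below \<open>h0\<close>, then
    \<open>h\<^sup>2 + k * h \<le> (1 + k) * h < m\<^sup>2 - s\<^sup>2\<close>, against the estimate
    drawn from \<open>cross\<close>. So \<open>c x\<close> stays uniformly away from 0 on unit
    vectors.\<close>
  define h0 where "h0 = min 1 ((m\<^sup>2 - s\<^sup>2) / (1 + k))"
  have m2s2: "s\<^sup>2 < m\<^sup>2" using sm by (simp add: power_strict_mono)
  then have h0: "h0 > 0" using k by (simp add: h0_def)
  have unit: "(norm (a x))\<^sup>2 \<le> m\<^sup>2 - h0\<^sup>2" if x: "norm x = 1" for x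
  proof -
    define h where "h = norm (c x)"
    have h: "h \<ge> 0" by (simp add: h_def)
    have e1: "(norm (a x))\<^sup>2 = m\<^sup>2 - h\<^sup>2" using ncx[of x] x by (simp add: h_def)
    have "(norm (a x + d a x))\<^sup>2 = (norm (a x))\<^sup>2 + 2 * (d a x \<bullet> a x) + (norm (d a x))\<^sup>2"
      unfolding power2_norm_eq_inner by (simp add: inner_add_left inner_add_right inner_commute)
    moreover have "norm (a x + d a x) \<le> s"
      using norm_blinfun[of "a + d a" x] x by (simp add: s_def blinfun.add_left)
    then have "(norm (a x + d a x))\<^sup>2 \<le> s\<^sup>2" by (simp add: power_mono)
    moreover have "\<bar>d c x \<bullet> c x\<bar> \<le> norm (d c) * h"
      using Cauchy_Schwarz_ineq2[of "d c x" "c x"] mult_right_mono[OF norm_blinfun[of "d c" x] h] x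
      by (simp add: h_def)
    ultimately have "m\<^sup>2 - h\<^sup>2 \<le> s\<^sup>2 + k * h"
      using cross[of x] zero_le_power2[of "norm (d a x)"] unfolding e1 k_def by linarith
    have "h0 \<le> h"
    proof (rule ccontr)
      assume "\<not> h0 \<le> h"
      then have "h < 1" and "h < (m\<^sup>2 - s\<^sup>2) / (1 + k)" by (simp_all add: h0_def)
      then have "h * (1 + k) < m\<^sup>2 - s\<^sup>2"
        using k pos_less_divide_eq[of "1 + k" h "m\<^sup>2 - s\<^sup>2"] by linarith
      moreover have "h\<^sup>2 \<le> h" using h \<open>h < 1\<close> by (simp add: power2_eq_square mult_left_le)
      ultimately show False using \<open>m\<^sup>2 - h\<^sup>2 \<le> s\<^sup>2 + k * h\<close> by (simp add: algebra_simps)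
    qed
    then show ?thesis using h0 by (simp add: e1 power_mono)
  qed
  \<comment> \<open>The uniform gap would make the operator norm of \<open>a\<close> smaller than
    \<open>m\<close>; \<open>max 0\<close> keeps \<open>r\<close> nonnegative without producing a
    unit vector.\<close>
  define r where "r = sqrt (max 0 (m\<^sup>2 - h0\<^sup>2))"
  have "norm (a x) \<le> r * norm x" for x
  proof (cases "x = 0")
    case False
    have "norm (a ((1 / norm x) *\<^sub>R x)) \<le> r"
      unfolding r_def using unit[of "(1 / norm x) *\<^sub>R x"] False by (intro real_le_rsqrt) auto
    then show ?thesis using False by (simp add: blinfun.scaleR_right divide_le_eq)
  qed simp
  then have "m \<le> r" unfolding m_def by (intro norm_blinfun_bound) (auto simp: r_def)
  then have "m\<^sup>2 \<le> r\<^sup>2" using sm by (intro power_mono) auto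
  also have "\<dots> = max 0 (m\<^sup>2 - h0\<^sup>2)" by (simp add: r_def)
  also have "\<dots> < m\<^sup>2" using h0 sm by auto
  finally show False by simp
qed

text \<open>Makes the dissipative estimate available with every real factor, which closability below
  exploits.\<close>

lemma scaled: "jordan_derivation S (\<lambda>a. r *\<^sub>R d a)"
proof unfold_locales
  show "r *\<^sub>R d a \<in> S" if "a \<in> S" for a by (rule subspace_scale[OF sub into[OF that]])
qed (auto simp: sub add scale jordan scaleR_add_right blinfun_compose_linear)

lemma dissipative_scaled: "a \<in> S \<Longrightarrow> norm a \<le> norm (a + r *\<^sub>R d a)"
  using jordan_derivation.dissipative[OF scaled] .

text \<open>Closability: if \<open>a n\<close> tends to 0 and \<open>d (a n)\<close> to
  \<open>b\<close>, put \<open>c = - b\<close> and apply dissipativity with factor \<open>r\<close>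
  to \<open>(1 / r) *\<^sub>R a n + c\<close>. Letting \<open>n\<close> tend to infinity leaves
  \<open>norm c \<le> r * norm (d c)\<close>, and \<open>r\<close> tending to 0 gives
  \<open>c = 0\<close>.\<close>

lemma bounded: "\<exists>K\<ge>0. \<forall>a\<in>S. norm (d a) \<le> K * norm a"
proof (rule closed_graph_bounded[OF _ closed])
  show "subspace_linear S d" by unfold_locales
  fix a b assume a: "\<And>n. a n \<in> S" "a \<longlonglongrightarrow> 0" and b: "(\<lambda>n. d (a n)) \<longlonglongrightarrow> b"
  have "b \<in> S" using closed_sequentially[OF closed _ b] into[OF a(1)] by blast
  define c where "c = - b"
  have c: "c \<in> S" unfolding c_def by (rule subspace_neg[OF sub \<open>b \<in> S\<close>])
  have ineq: "norm c \<le> norm (c + b + r *\<^sub>R d c)" if r: "r > 0" for r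
  proof (rule LIMSEQ_le)
    let ?a = "\<lambda>n. (1 / r) *\<^sub>R a n + c"
    have "(\<lambda>n. norm (?a n)) \<longlonglongrightarrow> norm ((1 / r) *\<^sub>R 0 + c)" by (intro tendsto_intros a)
    then show "(\<lambda>n. norm (?a n)) \<longlonglongrightarrow> norm c" by simp
    have "?a n + r *\<^sub>R d (?a n) = ?a n + d (a n) + r *\<^sub>R d c" for n
      using r by (simp add: add[OF subspace_scale[OF sub a(1)] c] scale[OF a(1)] scaleR_add_right)
    moreover have "(\<lambda>n. norm (?a n + d (a n) + r *\<^sub>R d c)) \<longlonglongrightarrow> norm ((1 / r) *\<^sub>R 0 + c + b + r *\<^sub>R d c)"
      by (intro tendsto_intros a b)
    ultimately show "(\<lambda>n. norm (?a n + r *\<^sub>R d (?a n))) \<longlonglongrightarrow> norm (c + b + r *\<^sub>R d c)" by (simp add: add.assoc)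
    show "\<exists>N. \<forall>n\<ge>N. norm (?a n) \<le> norm (?a n + r *\<^sub>R d (?a n))"
      using dissipative_scaled subspace_add[OF sub subspace_scale[OF sub a(1)] c] by blast
  qed
  have "norm c \<le> norm (c + b + 0 *\<^sub>R d c)"
  proof (rule tendsto_lowerbound[of _ _ "at_right (0::real)"])
    show "((\<lambda>r. norm (c + b + r *\<^sub>R d c)) \<longlongrightarrow> norm (c + b + 0 *\<^sub>R d c)) (at_right 0)"
      by (intro tendsto_intros)
    show "\<forall>\<^sub>F r in at_right 0. norm c \<le> norm (c + b + r *\<^sub>R d c)"
      using ineq by (auto simp: eventually_at_filter)
  qed simp
  then show "b = 0" by (simp add: c_def)
qed

end

section \<open>Self-adjoint elements of a von Neumann algebra\<close>

lemma scaleC_op_apply [simp]: "blinfun_apply (scaleC_op c a) x = c *\<^sub>C a x"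
  by (simp add: scaleC_op.rep_eq)

lemma linear_scaleC: "linear (\<lambda>x :: 'h::chilbert_space. c *\<^sub>C x)"
  by (rule bounded_linear.linear[OF bounded_linear_scaleC])

lemma scaleC_minus_right: "c *\<^sub>C (- x) = - (c *\<^sub>C x)" for x :: "'h::chilbert_space"
  by (rule linear_neg[OF linear_scaleC])

lemma scaleC_diff_right: "c *\<^sub>C (x - y) = c *\<^sub>C x - c *\<^sub>C y" for x :: "'h::chilbert_space"
  by (rule linear_diff[OF linear_scaleC])

lemma scaleC_scaleR: "c *\<^sub>C (r *\<^sub>R x) = r *\<^sub>R (c *\<^sub>C x)" for x :: "'h::chilbert_space"
  by (rule linear_scale[OF linear_scaleC])

lemma scaleC_minus_one: "(-1) *\<^sub>C x = - x" for x :: "'h::chilbert_space"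
  using scaleC_of_real[of "-1" x] by simp

lemma cinner_scaleC_right: "cinner x (c *\<^sub>C y) = cnj c * cinner x y" for x :: "'h::chilbert_space"
  by (metis cinner_commute cinner_scaleC_left complex_cnj_mult)

lemma inner_ii_left: "(\<i> *\<^sub>C x) \<bullet> y = - (x \<bullet> (\<i> *\<^sub>C y))" for x :: "'h::chilbert_space"
  by (simp add: inner_eq_Re_cinner cinner_scaleC_left cinner_scaleC_right)

lemma Im_cinner: "Im (cinner x y) = x \<bullet> (\<i> *\<^sub>C y)" for x :: "'h::chilbert_space"
  by (simp add: inner_eq_Re_cinner cinner_scaleC_right)

text \<open>Rotate \<open>x\<close> by the phase \<open>c\<close> that makes the value real and
  nonnegative, then use the real Cauchy-Schwarz inequality.\<close>

lemma norm_cinner_le: "cmod (cinner x y) \<le> norm x * norm y" for x :: "'h::chilbert_space"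
proof (cases "cinner x y = 0")
  case False
  define z c where "z = cinner x y" and "c = cnj z / complex_of_real (cmod z)"
  have "cmod c = 1" using False by (simp add: c_def z_def norm_divide)
  have "c * z = complex_of_real (cmod z)"
    using False by (simp add: c_def z_def mult.commute[of "cnj _"] complex_norm_square[symmetric] power2_eq_square)
  then have "cmod z = (c *\<^sub>C x) \<bullet> y"
    by (simp add: inner_eq_Re_cinner cinner_scaleC_left z_def)
  also have "\<dots> \<le> norm x * norm y"
    using Cauchy_Schwarz_ineq2[of "c *\<^sub>C x" y] \<open>cmod c = 1\<close> by (simp add: norm_scaleC)
  finally show ?thesis by (simp add: z_def)
qed simp

lemma scaleC_op_simps:
  fixes a b :: "'h::chilbert_space \<Rightarrow>\<^sub>L 'h"
  shows "scaleC_op c (a + b) = scaleC_op c a + scaleC_op c b"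
    and "scaleC_op c (a - b) = scaleC_op c a - scaleC_op c b"
    and "scaleC_op c (- a) = - scaleC_op c a"
    and "scaleC_op c (r *\<^sub>R a) = r *\<^sub>R scaleC_op c a"
    and "scaleC_op c (scaleC_op e a) = scaleC_op (c * e) a"
    and "scaleC_op (complex_of_real r) a = r *\<^sub>R a"
    and "scaleC_op c a o\<^sub>L b = scaleC_op c (a o\<^sub>L b)"
    and "a \<in> bounded_ops \<Longrightarrow> a o\<^sub>L scaleC_op c b = scaleC_op c (a o\<^sub>L b)"
  by (auto intro!: blinfun_eqI simp: blinfun.bilinear_simps scaleC_add_right scaleC_diff_right
      scaleC_minus_right scaleC_scaleR scaleC_scaleC scaleC_of_real bounded_ops_def)

lemma scaleC_op_minus_one: "scaleC_op (-1) a = - a"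
  by (rule blinfun_eqI) (simp add: scaleC_minus_one blinfun.bilinear_simps)

lemma norm_scaleC_op: "norm (scaleC_op c a) = cmod c * norm a"
proof (cases "c = 0")
  case True
  then show ?thesis using scaleC_op_simps(6)[of 0 a] by simp
next
  case False
  have le: "norm (scaleC_op c a) \<le> cmod c * norm a" for c and a :: "'a \<Rightarrow>\<^sub>L 'a"
    by (rule norm_blinfun_bound) (auto simp: norm_scaleC norm_blinfun mult.assoc intro!: mult_left_mono)
  have "scaleC_op (inverse c) (scaleC_op c a) = a"
    using False scaleC_op_simps(6)[of 1 a] by (simp add: scaleC_op_simps)
  then have "norm a \<le> inverse (cmod c) * norm (scaleC_op c a)"
    using le[of "inverse c" "scaleC_op c a"] by (simp add: norm_inverse)
  then have "cmod c * norm a \<le> norm (scaleC_op c a)"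
    using False by (simp add: field_simps)
  with le[of c a] show ?thesis by simp
qed

lemma norm_compose_le1: "norm a \<le> 1 \<Longrightarrow> norm b \<le> C \<Longrightarrow> norm (a o\<^sub>L b) \<le> C"
  using norm_blinfun_compose[of a b] mult_mono[of "norm a" 1 "norm b" C] by simp

lemma norm_compose_le1_right: "norm a \<le> C \<Longrightarrow> norm b \<le> 1 \<Longrightarrow> norm (a o\<^sub>L b) \<le> C"
  using norm_blinfun_compose[of a b] mult_mono[of "norm a" C "norm b" 1]
    order_trans[OF norm_ge_zero, of a C] by simp

text \<open>Used with \<open>N = commutant M\<close>: the bicommutant condition turns these closure
  properties into properties of \<open>M\<close>.\<close>

lemma commutant_closed:
  assumes "N \<subseteq> bounded_ops"
  shows "subspace (commutant N)" "closed (commutant N)" "id_blinfun \<in> commutant N"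
    and "a \<in> commutant N \<Longrightarrow> b \<in> commutant N \<Longrightarrow> a o\<^sub>L b \<in> commutant N"
    and "a \<in> commutant N \<Longrightarrow> scaleC_op c a \<in> commutant N"
proof -
  show "subspace (commutant N)"
    unfolding subspace_def commutant_def bounded_ops_def
    by (auto simp: blinfun.bilinear_simps scaleC_add_right scaleC_scaleR blinfun_compose_linear
        linear_0[OF linear_scaleC] intro!: blinfun_eqI)
  show "id_blinfun \<in> commutant N"
    by (auto simp: commutant_def bounded_ops_def)
  show "a o\<^sub>L b \<in> commutant N" if "a \<in> commutant N" "b \<in> commutant N"
    using that by (auto simp: commutant_def bounded_ops_def) (metis blinfun_compose_assoc)
  show "scaleC_op c a \<in> commutant N" if "a \<in> commutant N"
    using that assms by (auto simp: commutant_def scaleC_op_simps)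
      (auto simp: bounded_ops_def scaleC_scaleC mult.commute)
  show "closed (commutant N)"
  proof (subst closed_sequential_limits, intro allI impI)
    fix a :: "nat \<Rightarrow> 'a \<Rightarrow>\<^sub>L 'a" and l assume "(\<forall>n. a n \<in> commutant N) \<and> a \<longlonglongrightarrow> l"
    then have a: "\<And>n. a n \<in> commutant N" and l: "a \<longlonglongrightarrow> l" by auto
    have lx: "(\<lambda>n. a n x) \<longlonglongrightarrow> l x" for x by (intro blinfun.tendsto l tendsto_const)
    have "l (c *\<^sub>C x) = c *\<^sub>C l x" for c x
    proof (rule LIMSEQ_unique[OF lx])
      have "a n (c *\<^sub>C x) = c *\<^sub>C a n x" for n using a by (simp add: commutant_def bounded_ops_def)
      then show "(\<lambda>n. a n (c *\<^sub>C x)) \<longlonglongrightarrow> c *\<^sub>C l x"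
        using bounded_linear.tendsto[OF bounded_linear_scaleC lx] by simp
    qed
    moreover have "l o\<^sub>L b = b o\<^sub>L l" if "b \<in> N" for b
    proof (rule LIMSEQ_unique)
      show "(\<lambda>n. a n o\<^sub>L b) \<longlonglongrightarrow> (l o\<^sub>L b)" by (intro tendsto_blinfun_compose l tendsto_const)
      have "a n o\<^sub>L b = b o\<^sub>L a n" for n using a that by (simp add: commutant_def)
      then show "(\<lambda>n. a n o\<^sub>L b) \<longlonglongrightarrow> (b o\<^sub>L l)"
        by (simp add: tendsto_blinfun_compose[OF tendsto_const l])
    qed
    ultimately show "l \<in> commutant N" by (simp add: commutant_def bounded_ops_def)
  qed
qed

section \<open>A von Neumann algebra and its adjoint operation\<close>

locale vn_algebra =
  fixes M :: "('h::chilbert_space \<Rightarrow>\<^sub>L 'h) set"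
  assumes vn: "von_neumann_algebra M"
begin

lemma bounded_ops: "a \<in> M \<Longrightarrow> a \<in> bounded_ops"
  using vn by (auto simp: von_neumann_algebra_def)

lemma M_eq: "M = commutant (commutant M)"
  using vn by (auto simp: von_neumann_algebra_def)

lemma commutant_subset: "commutant M \<subseteq> bounded_ops"
  by (auto simp: commutant_def)

lemma subspace_M: "subspace M"
  using commutant_closed(1)[OF commutant_subset] M_eq by simp

lemma closed_M: "closed M"
  using commutant_closed(2)[OF commutant_subset] M_eq by simp

lemma id_in: "id_blinfun \<in> M"
  using commutant_closed(3)[OF commutant_subset] M_eq by simp

lemma compose_in: "a \<in> M \<Longrightarrow> b \<in> M \<Longrightarrow> a o\<^sub>L b \<in> M"
  using commutant_closed(4)[OF commutant_subset] M_eq by simp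

lemma scaleC_op_in: "a \<in> M \<Longrightarrow> scaleC_op c a \<in> M"
  using commutant_closed(5)[OF commutant_subset] M_eq by simp

lemmas add_in = subspace_add[OF subspace_M]
  and diff_in = subspace_diff[OF subspace_M]
  and scaleR_in = subspace_scale[OF subspace_M]
  and zero_in = subspace_0[OF subspace_M]
  and neg_in = subspace_neg[OF subspace_M]

lemmas M_intros = id_in compose_in scaleC_op_in add_in diff_in scaleR_in zero_in neg_in

text \<open>The real inner product already determines an adjoint, and the complex adjoint satisfies
  the same condition, so on \<open>M\<close> this choice is the usual adjoint.\<close>

definition star :: "('h \<Rightarrow>\<^sub>L 'h) \<Rightarrow> ('h \<Rightarrow>\<^sub>L 'h)" where
  "star a = (SOME b. b \<in> M \<and> (\<forall>x y. a x \<bullet> y = x \<bullet> b y))"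

lemma star:
  assumes "a \<in> M"
  shows "star a \<in> M" "a x \<bullet> y = x \<bullet> star a y" "star a x \<bullet> y = x \<bullet> a y"
proof -
  obtain b where "b \<in> M" "is_adjoint a b"
    using vn assms by (auto simp: von_neumann_algebra_def)
  then have "\<exists>b. b \<in> M \<and> (\<forall>x y. a x \<bullet> y = x \<bullet> b y)"
    by (auto simp: is_adjoint_def inner_eq_Re_cinner)
  then have *: "star a \<in> M \<and> (\<forall>x y. a x \<bullet> y = x \<bullet> star a y)"
    unfolding star_def by (rule someI_ex)
  then show "star a \<in> M" "a x \<bullet> y = x \<bullet> star a y" by auto
  show "star a x \<bullet> y = x \<bullet> a y" using * by (metis inner_commute)
qed

lemma star_unique:
  fixes b :: "'h \<Rightarrow>\<^sub>L 'h"
  assumes "a \<in> M" "\<And>x y. a x \<bullet> y = x \<bullet> b y"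
  shows "star a = b"
proof (rule blinfun_eqI)
  fix y
  have "x \<bullet> (star a y - b y) = 0" for x
    using assms(2)[of x y] star(2)[OF assms(1), of x y] by (simp add: inner_diff_right)
  then show "star a y = b y" by (metis inner_eq_zero_iff right_minus_eq)
qed

lemma star_add: "a \<in> M \<Longrightarrow> b \<in> M \<Longrightarrow> star (a + b) = star a + star b"
  by (rule star_unique) (auto simp: M_intros blinfun.bilinear_simps inner_simps star)

lemma star_scaleR: "a \<in> M \<Longrightarrow> star (r *\<^sub>R a) = r *\<^sub>R star a"
  by (rule star_unique) (auto simp: M_intros blinfun.bilinear_simps inner_simps star)

lemma star_compose: "a \<in> M \<Longrightarrow> b \<in> M \<Longrightarrow> star (a o\<^sub>L b) = star b o\<^sub>L star a"
  by (rule star_unique) (auto simp: M_intros star)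

lemma star_ii: "a \<in> M \<Longrightarrow> star (scaleC_op \<i> a) = - scaleC_op \<i> (star a)"
  using bounded_ops[OF star(1)]
  by (intro star_unique) (auto simp: M_intros blinfun.bilinear_simps inner_ii_left star bounded_ops_def)

lemma norm_star_le:
  assumes "a \<in> M"
  shows "norm (star a) \<le> norm a"
proof (rule norm_blinfun_bound)
  fix y
  have "norm (star a y) * norm (star a y) = a (star a y) \<bullet> y"
    by (simp add: star(2)[OF assms] power2_norm_eq_inner[symmetric] power2_eq_square[symmetric])
  also have "\<dots> \<le> norm (a (star a y)) * norm y" by (rule norm_cauchy_schwarz)
  also have "\<dots> \<le> (norm a * norm (star a y)) * norm y" by (intro mult_right_mono norm_blinfun) simp
  finally show "norm (star a y) \<le> norm a * norm y"
    by (cases "norm (star a y) = 0") (auto simp: mult.assoc mult.left_commute)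
qed simp

definition sa :: "('h \<Rightarrow>\<^sub>L 'h) set" where
  "sa = {a \<in> M. \<forall>x y. a x \<bullet> y = x \<bullet> a y}"

lemma sa_M: "a \<in> sa \<Longrightarrow> a \<in> M"
  by (simp add: sa_def)

lemma sa_iff: "a \<in> sa \<longleftrightarrow> a \<in> M \<and> star a = a"
  using star_unique[of a a] star(2)[of a] by (auto simp: sa_def)

sublocale sa: symmetric_jordan_algebra sa
proof
  show "subspace sa"
    by (auto simp: subspace_def sa_def M_intros blinfun.bilinear_simps inner_simps)
  show "id_blinfun \<in> sa" by (simp add: sa_def M_intros)
  show "a o\<^sub>L a \<in> sa" if "a \<in> sa" for a using that by (simp add: sa_def M_intros)
  show "a x \<bullet> y = x \<bullet> a y" if "a \<in> sa" for a x y using that by (simp add: sa_def)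
  show "closed sa"
  proof (subst closed_sequential_limits, intro allI impI)
    fix a l assume "(\<forall>n. a n \<in> sa) \<and> a \<longlonglongrightarrow> l"
    then have a: "\<And>n. a n \<in> sa" and l: "a \<longlonglongrightarrow> l" by auto
    have "l \<in> M" using closed_sequentially[OF closed_M _ l] a sa_M by blast
    moreover have "l x \<bullet> y = x \<bullet> l y" for x y
    proof (rule LIMSEQ_unique)
      show "(\<lambda>n. a n x \<bullet> y) \<longlonglongrightarrow> l x \<bullet> y" by (intro tendsto_intros blinfun.tendsto l)
      have "a n x \<bullet> y = x \<bullet> a n y" for n using a by (simp add: sa_def)
      then show "(\<lambda>n. a n x \<bullet> y) \<longlonglongrightarrow> x \<bullet> l y"
        by (simp) (intro tendsto_intros blinfun.tendsto l)
    qed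
    ultimately show "l \<in> sa" by (simp add: sa_def)
  qed
qed

text \<open>Since \<open>a\<close> is complex linear, testing the real symmetry at
  \<open>\<i> *\<^sub>C y\<close> gives the imaginary part.\<close>

lemma sa_self_adjoint:
  assumes "a \<in> sa"
  shows "cinner (a x) y = cinner x (a y)"
proof (rule complex_eqI)
  show "Re (cinner (a x) y) = Re (cinner x (a y))"
    using sa.symmetric[OF assms, of x y] by (simp add: inner_eq_Re_cinner)
  have "a (\<i> *\<^sub>C y) = \<i> *\<^sub>C a y"
    using bounded_ops[OF sa_M[OF assms]] by (simp add: bounded_ops_def)
  then show "Im (cinner (a x) y) = Im (cinner x (a y))"
    using sa.symmetric[OF assms, of x "\<i> *\<^sub>C y"] by (simp add: Im_cinner)
qed

lemma re_part_sa: "a \<in> M \<Longrightarrow> (1/2) *\<^sub>R (a + star a) \<in> sa"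
  by (auto simp: sa_def M_intros star(1) star(2,3)[of a] blinfun.bilinear_simps inner_simps)

text \<open>\<open>h\<close> is the real part of \<open>a\<close> and \<open>k\<close> that of
  \<open>-\<i>\<close> times \<open>a\<close>; averaging with the adjoint does not increase the
  norm.\<close>

lemma cartesian_decomposition:
  assumes "a \<in> M"
  obtains h k where "h \<in> sa" "k \<in> sa" "a = h + scaleC_op \<i> k" "norm h \<le> norm a" "norm k \<le> norm a"
proof -
  define re where "re b = (1/2) *\<^sub>R (b + star b)" for b
  have norm_re: "norm (re b) \<le> norm b" if "b \<in> M" for b
    using norm_triangle_ineq[of b "star b"] norm_star_le[OF that] by (simp add: re_def)
  define b where "b = - scaleC_op \<i> a"
  have b: "b \<in> M" using assms by (simp add: b_def M_intros)
  have "star b = scaleC_op \<i> (star a)"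
    using star_scaleR[OF scaleC_op_in[OF assms], of "-1" \<i>] star_ii[OF assms] by (simp add: b_def)
  then have "re a + scaleC_op \<i> (re b) = a"
    by (simp add: re_def b_def scaleC_op_simps scaleC_op_minus_one scaleR_add_right[symmetric]
        scaleR_2[symmetric] del: scaleR_add_right)
  moreover have "norm b = norm a" by (simp add: b_def norm_scaleC_op)
  ultimately show ?thesis
    using that[of "re a" "re b"] re_part_sa[OF assms] re_part_sa[OF b] norm_re[OF assms] norm_re[OF b]
    by (simp add: re_def)
qed

end

section \<open>Derivations of von Neumann algebras\<close>

locale vn_derivation = vn_algebra M for M :: "('h::chilbert_space \<Rightarrow>\<^sub>L 'h) set" +
  fixes d :: "('h \<Rightarrow>\<^sub>L 'h) \<Rightarrow> ('h \<Rightarrow>\<^sub>L 'h)"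
  assumes d_in: "\<And>a. a \<in> M \<Longrightarrow> d a \<in> M"
    and d_add: "\<And>a b. a \<in> M \<Longrightarrow> b \<in> M \<Longrightarrow> d (a + b) = d a + d b"
    and d_scaleC: "\<And>c a. a \<in> M \<Longrightarrow> d (scaleC_op c a) = scaleC_op c (d a)"
    and leibniz: "\<And>a b. a \<in> M \<Longrightarrow> b \<in> M \<Longrightarrow> d (a o\<^sub>L b) = (d a o\<^sub>L b) + (a o\<^sub>L d b)"
begin

lemma d_scaleR: "a \<in> M \<Longrightarrow> d (r *\<^sub>R a) = r *\<^sub>R d a"
  using d_scaleC[of a "complex_of_real r"] by (simp add: scaleC_op_simps)

sublocale subspace_linear M d
  by unfold_locales (auto simp: subspace_M d_add d_scaleR)

text \<open>The adjoint fixes \<open>a\<close> and reverses products, so \<open>star (e a)\<close>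
  obeys the same rule on squares with its two terms swapped; the average also lands in
  \<open>sa\<close>.\<close>

lemma re_part_jordan:
  assumes e: "subspace_linear sa e" and e_in: "\<And>a. a \<in> sa \<Longrightarrow> e a \<in> M"
    and jordan: "\<And>a. a \<in> sa \<Longrightarrow> e (a o\<^sub>L a) = (e a o\<^sub>L a) + (a o\<^sub>L e a)"
  shows "jordan_derivation sa (\<lambda>a. (1/2) *\<^sub>R (e a + star (e a)))"
proof -
  interpret e: subspace_linear sa e by (rule e)
  show ?thesis
  proof unfold_locales
    fix a assume a: "a \<in> sa"
    then have aM: "a \<in> M" and a': "star a = a" by (auto simp: sa_iff)
    show "(1/2) *\<^sub>R (e a + star (e a)) \<in> sa" by (rule re_part_sa[OF e_in[OF a]])
    have "star (e (a o\<^sub>L a)) = (a o\<^sub>L star (e a)) + (star (e a) o\<^sub>L a)"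
      using a aM e_in[OF a] a' by (simp add: jordan star_add star_compose M_intros)
    then show "(1/2) *\<^sub>R (e (a o\<^sub>L a) + star (e (a o\<^sub>L a)))
        = ((1/2) *\<^sub>R (e a + star (e a)) o\<^sub>L a) + (a o\<^sub>L (1/2) *\<^sub>R (e a + star (e a)))"
      using a by (simp add: jordan blinfun_compose_linear scaleR_add_right)
  qed (auto simp: sa.sub e.add e.scale star_add star_scaleR e_in scaleR_add_right)
qed

text \<open>The real part of \<open>e\<close> is the imaginary part of \<open>d\<close>. Both parts
  are Jordan derivations of \<open>sa\<close>, hence bounded, and the Cartesian decomposition
  carries the bound to \<open>M\<close> at the cost of a factor 2.\<close>

lemma bounded: "\<exists>K\<ge>0. \<forall>a\<in>M. norm (d a) \<le> K * norm a"
proof -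
  define e where "e a = - scaleC_op \<i> (d a)" for a
  have d_sa: "subspace_linear sa d"
    by unfold_locales (auto simp: sa.sub sa_M d_add d_scaleR)
  have e_sa: "subspace_linear sa e"
    by unfold_locales (auto simp: sa.sub sa_M d_add d_scaleR e_def scaleC_op_simps)
  interpret re: jordan_derivation sa "\<lambda>a. (1/2) *\<^sub>R (d a + star (d a))"
    by (rule re_part_jordan[OF d_sa]) (auto simp: sa_M d_in leibniz)
  interpret im: jordan_derivation sa "\<lambda>a. (1/2) *\<^sub>R (e a + star (e a))"
    by (rule re_part_jordan[OF e_sa])
      (auto simp: sa_M d_in leibniz e_def M_intros scaleC_op_simps bounded_ops blinfun_compose_linear
        bounded_bilinear.minus_left[OF bounded_bilinear_blinfun_compose]
        bounded_bilinear.minus_right[OF bounded_bilinear_blinfun_compose])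
  obtain K1 where K1: "K1 \<ge> 0" "\<And>a. a \<in> sa \<Longrightarrow> norm ((1/2) *\<^sub>R (d a + star (d a))) \<le> K1 * norm a"
    using re.bounded by blast
  obtain K2 where K2: "K2 \<ge> 0" "\<And>a. a \<in> sa \<Longrightarrow> norm ((1/2) *\<^sub>R (e a + star (e a))) \<le> K2 * norm a"
    using im.bounded by blast
  have sa_bound: "norm (d a) \<le> (K1 + K2) * norm a" if a: "a \<in> sa" for a
  proof -
    have "star (e a) = scaleC_op \<i> (star (d a))"
      using star_scaleR[OF scaleC_op_in[OF d_in[OF sa_M[OF a]]], of "-1" \<i>] star_ii[OF d_in[OF sa_M[OF a]]]
      by (simp add: e_def)
    then have "d a = (1/2) *\<^sub>R (d a + star (d a)) + scaleC_op \<i> ((1/2) *\<^sub>R (e a + star (e a)))"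
      by (simp add: e_def scaleC_op_simps scaleC_op_minus_one scaleR_add_right[symmetric]
        scaleR_2[symmetric] del: scaleR_add_right)
    then have "norm (d a) \<le> norm ((1/2) *\<^sub>R (d a + star (d a))) + norm (scaleC_op \<i> ((1/2) *\<^sub>R (e a + star (e a))))"
      using norm_triangle_ineq by metis
    also have "\<dots> \<le> K1 * norm a + K2 * norm a"
      using K1(2)[OF a] K2(2)[OF a] by (intro add_mono) (simp_all add: norm_scaleC_op)
    finally show ?thesis by (simp add: distrib_right)
  qed
  have "norm (d a) \<le> 2 * (K1 + K2) * norm a" if aM: "a \<in> M" for a
  proof -
    obtain h k where hk: "h \<in> sa" "k \<in> sa" "a = h + scaleC_op \<i> k" "norm h \<le> norm a" "norm k \<le> norm a"
      using cartesian_decomposition[OF aM] by blast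
    have "d a = d h + scaleC_op \<i> (d k)"
      using hk by (simp add: d_add d_scaleC sa_M M_intros)
    then have "norm (d a) \<le> norm (d h) + norm (d k)"
      using norm_triangle_ineq[of "d h" "scaleC_op \<i> (d k)"] by (simp add: norm_scaleC_op)
    also have "\<dots> \<le> (K1 + K2) * norm a + (K1 + K2) * norm a"
      using hk sa_bound K1(1) K2(1) by (intro add_mono) (meson add_nonneg_nonneg mult_left_mono order_trans)+
    finally show ?thesis by (simp add: algebra_simps)
  qed
  then show ?thesis using K1(1) K2(1) by (intro exI[of _ "2 * (K1 + K2)"]) auto
qed

definition K :: real where
  "K = (SOME K. K \<ge> 0 \<and> (\<forall>a\<in>M. norm (d a) \<le> K * norm a))"

lemma K: "K \<ge> 0" "a \<in> M \<Longrightarrow> norm (d a) \<le> K * norm a"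
proof -
  have "K \<ge> 0 \<and> (\<forall>a\<in>M. norm (d a) \<le> K * norm a)"
    unfolding K_def using bounded by (rule someI_ex)
  then show "K \<ge> 0" "a \<in> M \<Longrightarrow> norm (d a) \<le> K * norm a" by auto
qed

text \<open>
  Write \<open>a = (u - u\<^sup>*) / 2i\<close> with \<open>u = (1 - a\<^sup>2)\<^sup>1\<^sup>/\<^sup>2 + i a\<close> unitary, and average \<open>d (u\<^sup>n) u\<^sup>-\<^sup>n\<close> over \<open>n < N\<close>.
\<close>

lemma almost_inner:
  assumes a: "a \<in> sa" "norm a \<le> 1" and N: "N > 0"
  shows "\<exists>A. norm A \<le> K \<and> norm (d a - ((A o\<^sub>L a) - (a o\<^sub>L A))) \<le> K / real N"
proof -
  obtain c where c: "c \<in> sa" "c o\<^sub>L c = id_blinfun - (a o\<^sub>L a)" "a o\<^sub>L c = c o\<^sub>L a"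
    using sa.sqrt_norm_minus_square[OF a] by auto
  note ops = bounded_ops[OF sa_M[OF a(1)]] bounded_ops[OF sa_M[OF c(1)]]
  define u v where "u = c + scaleC_op \<i> a" and "v = c - scaleC_op \<i> a"
  have uM: "u \<in> M" and vM: "v \<in> M" using a c by (simp_all add: u_def v_def M_intros sa_M)
  have uv: "u o\<^sub>L v = id_blinfun" and vu: "v o\<^sub>L u = id_blinfun"
    using ops by (simp_all add: u_def v_def blinfun_compose_linear scaleC_op_simps c(2,3) scaleC_op_minus_one)
  have u_inner: "u x \<bullet> y = x \<bullet> v y" for x y
  proof -
    have "a (\<i> *\<^sub>C y) = \<i> *\<^sub>C a y" using ops by (simp add: bounded_ops_def)
    then show ?thesis
      by (simp add: u_def v_def blinfun.bilinear_simps inner_simps inner_ii_left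
        sa.symmetric[OF a(1)] sa.symmetric[OF c(1)])
  qed
  have apply_uv: "u (v x) = x" "v (u x) = x" for x
    using arg_cong[OF uv, of "\<lambda>t. t x"] arg_cong[OF vu, of "\<lambda>t. t x"] by simp_all
  have iso_u: "norm (u x) = norm x" for x
    by (simp add: norm_eq_sqrt_inner u_inner apply_uv)
  have iso_v: "norm (v x) = norm x" for x
    using iso_u[of "v x"] by (simp add: apply_uv)
  have nu: "norm u \<le> 1" and nv: "norm v \<le> 1"
    by (rule norm_blinfun_bound; simp add: iso_u iso_v)+
  define U where "U = rec_nat id_blinfun (\<lambda>_ t. u o\<^sub>L t)"
  define V where "V = rec_nat id_blinfun (\<lambda>_ t. t o\<^sub>L v)"
  have U: "U 0 = id_blinfun" "\<And>n. U (Suc n) = u o\<^sub>L U n"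
    and V: "V 0 = id_blinfun" "\<And>n. V (Suc n) = V n o\<^sub>L v" by (simp_all add: U_def V_def)
  have UM: "U n \<in> M" for n by (induction n) (auto simp: U M_intros uM)
  have nU: "norm (U n) \<le> 1" for n
    by (induction n) (auto simp: U norm_blinfun_id_le intro: norm_compose_le1 nu)
  have nV: "norm (V n) \<le> 1" for n
    by (induction n) (auto simp: V norm_blinfun_id_le intro: norm_compose_le1 nv)
  have UV: "U n o\<^sub>L V n = id_blinfun" for n
  proof (induction n)
    case (Suc n)
    have "U (Suc n) o\<^sub>L V (Suc n) = u o\<^sub>L ((U n o\<^sub>L V n) o\<^sub>L v)"
      by (simp add: U V blinfun_compose_assoc)
    then show ?case by (simp add: Suc uv)
  qed (simp add: U V)
  define B where "B n = d (U n) o\<^sub>L V n" for n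
  have d_id: "d id_blinfun = 0" using leibniz[OF id_in id_in] by simp
  have B0: "B 0 = 0" by (simp add: B_def U V d_id)
  have nB: "norm (B n) \<le> K" for n
    unfolding B_def
    by (rule norm_compose_le1_right[OF _ nV], rule order_trans[OF K(2)[OF UM]])
      (use mult_left_mono[OF nU K(1)] in simp)
  \<comment> \<open>Leibniz rule for \<open>u o\<^sub>L U n\<close>: conjugation by \<open>u\<close>
    shifts the index up to the fixed term \<open>d u o\<^sub>L v\<close>.\<close>
  have step: "u o\<^sub>L (B n o\<^sub>L v) = B (Suc n) - (d u o\<^sub>L v)" for n
  proof -
    have "B (Suc n) = (d u o\<^sub>L ((U n o\<^sub>L V n) o\<^sub>L v)) + (u o\<^sub>L (B n o\<^sub>L v))"
      by (simp add: B_def U V leibniz[OF uM UM] blinfun_compose_linear blinfun_compose_assoc)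
    then show ?thesis by (simp add: UV)
  qed
  define A where "A = (1 / real N) *\<^sub>R (\<Sum>n<N. B n)"
  have nA: "norm A \<le> K"
  proof -
    have "norm (\<Sum>n<N. B n) \<le> (\<Sum>n<N. K)" by (rule sum_norm_le) (rule nB)
    then show ?thesis using N by (simp add: A_def field_simps)
  qed
  \<comment> \<open>Complex linearity lets the scalar \<open>\<i>\<close> pass through
    \<open>A\<close> when \<open>A o\<^sub>L u\<close> is expanded.\<close>
  have A_ops: "A \<in> bounded_ops"
  proof -
    have "B n \<in> bounded_ops" for n
    proof -
      have "V n \<in> M" for n by (induction n) (auto simp: V M_intros vM)
      then show ?thesis by (simp add: B_def bounded_ops M_intros d_in UM)
    qed
    then have "(\<Sum>n<m. B n) \<in> bounded_ops" for m
      by (induction m) (auto simp: bounded_ops_def blinfun.bilinear_simps scaleC_add_right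
          linear_0[OF linear_scaleC])
    then show ?thesis
      by (simp add: A_def bounded_ops_def blinfun.bilinear_simps scaleC_scaleR)
  qed
  define E where "E = (1 / real N) *\<^sub>R (B N o\<^sub>L u)"
  have nE: "norm E \<le> K / N"
    using norm_compose_le1_right[OF nB nu, of N] N by (simp add: E_def field_simps)
  \<comment> \<open>Conjugation shifts the whole sum by one index; as \<open>B 0 = 0\<close>, only
    the boundary term \<open>B m\<close> is gained. After averaging it becomes the error
    \<open>E\<close>.\<close>
  have "u o\<^sub>L ((\<Sum>n<m. B n) o\<^sub>L v) = (\<Sum>n<m. B n) + B m - real m *\<^sub>R (d u o\<^sub>L v)" for m
  proof (induction m)
    case (Suc m)
    then show ?case using step[of m] by (simp add: blinfun_compose_linear scaleR_add_left)
  qed (simp add: B0)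
  then have "u o\<^sub>L (A o\<^sub>L v) = A + (1 / real N) *\<^sub>R B N - (d u o\<^sub>L v)"
    using N by (simp add: A_def blinfun_compose_linear scaleR_add_right scaleR_diff_right)
  then have "(u o\<^sub>L (A o\<^sub>L v)) o\<^sub>L u = (A + (1 / real N) *\<^sub>R B N - (d u o\<^sub>L v)) o\<^sub>L u"
    by simp
  then have "u o\<^sub>L A = (A o\<^sub>L u) + E - d u"
    by (simp add: E_def blinfun_compose_linear blinfun_compose_assoc vu)
  then have du: "d u = (A o\<^sub>L u) - (u o\<^sub>L A) + E" by (simp add: algebra_simps)
  \<comment> \<open>Differentiating \<open>v o\<^sub>L u = id_blinfun\<close> expresses
    \<open>d v\<close> through \<open>d u\<close>.\<close>
  have dv: "d v = (A o\<^sub>L v) - (v o\<^sub>L A) - (v o\<^sub>L (E o\<^sub>L v))"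
  proof -
    have "(d v o\<^sub>L u) + (v o\<^sub>L d u) = 0" using leibniz[OF vM uM] by (simp add: vu d_id)
    then have "(d v o\<^sub>L u) = - (v o\<^sub>L d u)" by (simp add: add_eq_0_iff2)
    then have "(d v o\<^sub>L u) o\<^sub>L v = (- (v o\<^sub>L d u)) o\<^sub>L v" by simp
    then have "d v = - (v o\<^sub>L (d u o\<^sub>L v))"
      by (simp add: blinfun_compose_assoc uv bounded_bilinear.minus_left[OF bounded_bilinear_blinfun_compose])
    moreover have "v o\<^sub>L ((A o\<^sub>L u) o\<^sub>L v) = v o\<^sub>L A" by (simp add: blinfun_compose_assoc uv)
    moreover have "v o\<^sub>L ((u o\<^sub>L A) o\<^sub>L v) = A o\<^sub>L v"
      by (simp add: blinfun_compose_assoc[symmetric] vu)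
    ultimately show ?thesis by (simp add: du blinfun_compose_linear)
  qed
  define R where "R = d a - ((A o\<^sub>L a) - (a o\<^sub>L A))"
  \<comment> \<open>Subtracting the formulas for \<open>d u\<close> and \<open>d v\<close> isolates
    \<open>d a\<close>; two error terms of norm at most \<open>K / N\<close> remain, and the factor
    2 absorbs them.\<close>
  have "u - v = 2 *\<^sub>R scaleC_op \<i> a" by (simp add: u_def v_def scaleR_2)
  then have "d u - d v = 2 *\<^sub>R scaleC_op \<i> (d a)"
    using diff[OF uM vM] d_scaleR[OF scaleC_op_in[OF sa_M[OF a(1)]], of 2 \<i>] d_scaleC[OF sa_M[OF a(1)]] by simp
  moreover have "(A o\<^sub>L u) - (A o\<^sub>L v) = 2 *\<^sub>R scaleC_op \<i> (A o\<^sub>L a)"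
    using A_ops by (simp add: u_def v_def blinfun_compose_linear scaleC_op_simps scaleR_2)
  moreover have "(u o\<^sub>L A) - (v o\<^sub>L A) = 2 *\<^sub>R scaleC_op \<i> (a o\<^sub>L A)"
    by (simp add: u_def v_def blinfun_compose_linear scaleC_op_simps scaleR_2)
  moreover have "2 *\<^sub>R scaleC_op \<i> R = 2 *\<^sub>R scaleC_op \<i> (d a)
      - (2 *\<^sub>R scaleC_op \<i> (A o\<^sub>L a) - 2 *\<^sub>R scaleC_op \<i> (a o\<^sub>L A))"
    by (simp add: R_def scaleC_op_simps scaleR_diff_right)
  ultimately have "2 *\<^sub>R scaleC_op \<i> R
      = (d u - d v) - (((A o\<^sub>L u) - (A o\<^sub>L v)) - ((u o\<^sub>L A) - (v o\<^sub>L A)))"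
    by simp
  also have "\<dots> = E + (v o\<^sub>L (E o\<^sub>L v))" by (simp add: du dv)
  finally have "2 *\<^sub>R scaleC_op \<i> R = E + (v o\<^sub>L (E o\<^sub>L v))" .
  then have "2 * norm R = norm (E + (v o\<^sub>L (E o\<^sub>L v)))"
    using norm_scaleR[of 2 "scaleC_op \<i> R"] by (simp add: norm_scaleC_op)
  also have "\<dots> \<le> K / N + K / N"
    by (rule norm_triangle_mono[OF nE norm_compose_le1[OF nv norm_compose_le1_right[OF nE nv]]])
  finally have "norm R \<le> K / N" by simp
  with nA show ?thesis by (auto simp: R_def)
qed

text \<open>The operator \<open>A\<close> varies with \<open>N\<close>, but only its norm bound
  \<open>K\<close> enters, so the remainder disappears in the limit. A general \<open>a\<close> is
  normalised first.\<close>

lemma inner_bound: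
  assumes a: "a \<in> sa"
  shows "\<bar>d a x \<bullet> y\<bar> \<le> K * (norm (a x) * norm y + norm x * norm (a y))"
proof (cases "a = 0")
  case True
  then show ?thesis using zero by simp
next
  case False
  have unit: "\<bar>d a x \<bullet> y\<bar> \<le> K * (norm (a x) * norm y + norm x * norm (a y))"
    if a: "a \<in> sa" "norm a \<le> 1" for a
  proof (rule LIMSEQ_le)
    let ?b = "K * (norm (a x) * norm y + norm x * norm (a y))"
    show "(\<lambda>n. \<bar>d a x \<bullet> y\<bar>) \<longlonglongrightarrow> \<bar>d a x \<bullet> y\<bar>" by simp
    have "(\<lambda>n. ?b + K * norm x * norm y * inverse (real (Suc n))) \<longlonglongrightarrow> ?b + K * norm x * norm y * 0"
      by (intro tendsto_intros LIMSEQ_inverse_real_of_nat)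
    then show "(\<lambda>n. ?b + K * norm x * norm y * inverse (real (Suc n))) \<longlonglongrightarrow> ?b" by simp
    have "\<bar>d a x \<bullet> y\<bar> \<le> ?b + K * norm x * norm y * inverse (real (Suc n))" for n
    proof -
      obtain A where A: "norm A \<le> K" "norm (d a - ((A o\<^sub>L a) - (a o\<^sub>L A))) \<le> K / real (Suc n)"
        using almost_inner[OF a, of "Suc n"] by auto
      define R where "R = d a - ((A o\<^sub>L a) - (a o\<^sub>L A))"
      have "d a = (A o\<^sub>L a) - (a o\<^sub>L A) + R" by (simp add: R_def)
      then have "d a x \<bullet> y = A (a x) \<bullet> y - A x \<bullet> a y + R x \<bullet> y"
        by (simp add: blinfun.bilinear_simps inner_simps sa.symmetric[OF a(1)])
      moreover have "\<bar>t z \<bullet> w\<bar> \<le> C * (norm z * norm w)" if "norm t \<le> C" for t :: "'h \<Rightarrow>\<^sub>L 'h" and z w C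
      proof -
        have "\<bar>t z \<bullet> w\<bar> \<le> norm (t z) * norm w" by (rule Cauchy_Schwarz_ineq2)
        also have "\<dots> \<le> (norm t * norm z) * norm w" by (intro mult_right_mono norm_blinfun) simp
        also have "\<dots> \<le> (C * norm z) * norm w" by (intro mult_right_mono that) auto
        finally show ?thesis by (simp add: mult.assoc)
      qed
      ultimately have "\<bar>d a x \<bullet> y\<bar> \<le> K * (norm (a x) * norm y) + K * (norm x * norm (a y))
          + K / real (Suc n) * (norm x * norm y)"
        using A unfolding R_def[symmetric] by (smt (verit, best))
      then show ?thesis by (simp add: distrib_left divide_inverse mult_ac)
    qed
    then show "\<exists>N. \<forall>n\<ge>N. \<bar>d a x \<bullet> y\<bar> \<le> ?b + K * norm x * norm y * inverse (real (Suc n))" by blast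
  qed
  define r where "r = 1 / norm a"
  have r: "r > 0" using False by (simp add: r_def)
  have "\<bar>d (r *\<^sub>R a) x \<bullet> y\<bar> \<le> K * (norm ((r *\<^sub>R a) x) * norm y + norm x * norm ((r *\<^sub>R a) y))"
    by (rule unit) (simp_all add: subspace_scale[OF sa.sub a] r_def)
  then have "r * \<bar>d a x \<bullet> y\<bar> \<le> r * (K * (norm (a x) * norm y + norm x * norm (a y)))"
    using r by (simp add: d_scaleR sa_M[OF a] blinfun.bilinear_simps abs_mult algebra_simps)
  then show ?thesis using r by simp
qed

text \<open>Riesz representation through \<open>J a = (a x, a y)\<close>, whose norm dominates those
  of \<open>a x\<close> and \<open>a y\<close>; \<open>v\<close> and \<open>w\<close> are the
  components of the representing pair.\<close>

lemma inner_representation: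
  "\<exists>v w. norm v \<le> K * (norm x + norm y) \<and> norm w \<le> K * (norm x + norm y)
    \<and> (\<forall>a\<in>sa. d a x \<bullet> y = a x \<bullet> v + a y \<bullet> w)"
proof -
  define J where "J a = (blinfun_apply a x, blinfun_apply a y)" for a :: "'h \<Rightarrow>\<^sub>L 'h"
  have "linear J" by (rule linearI) (simp_all add: J_def blinfun.bilinear_simps)
  have "\<exists>p. (\<forall>a\<in>sa. d a x \<bullet> y = J a \<bullet> p) \<and> norm p \<le> K * (norm x + norm y)"
  proof (rule riesz_parametrized[OF _ \<open>linear J\<close>])
    show "subspace_linear sa (\<lambda>a. d a x \<bullet> y)"
      by unfold_locales (auto simp: sa.sub sa_M d_add d_scaleR blinfun.bilinear_simps inner_simps)
    show "\<bar>d a x \<bullet> y\<bar> \<le> K * (norm x + norm y) * norm (J a)" if "a \<in> sa" for a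
    proof -
      have "norm (a x) \<le> norm (J a)" "norm (a y) \<le> norm (J a)"
        using norm_fst_le[of "a x" "a y"] norm_snd_le[of "a y" "a x"] by (auto simp: J_def)
      then have "norm (a x) * norm y + norm x * norm (a y) \<le> norm (J a) * norm y + norm x * norm (J a)"
        by (intro add_mono mult_right_mono mult_left_mono) auto
      then have "K * (norm (a x) * norm y + norm x * norm (a y)) \<le> K * (norm (J a) * norm y + norm x * norm (J a))"
        using K(1) by (rule mult_left_mono)
      with inner_bound[OF that, of x y] show ?thesis by (simp add: algebra_simps)
    qed
  qed (use K(1) in simp)
  then obtain p where p: "\<And>a. a \<in> sa \<Longrightarrow> d a x \<bullet> y = J a \<bullet> p" "norm p \<le> K * (norm x + norm y)" by blast
  show ?thesis
    using p norm_fst_le[of "fst p" "snd p"] norm_snd_le[of "snd p" "fst p"]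
    by (intro exI[of _ "fst p"] exI[of _ "snd p"]) (auto simp: J_def inner_prod_def)
qed

end

section \<open>Weak* continuity on the fibre\<close>

definition square_summable :: "(nat \<Rightarrow> 'h::real_normed_vector) \<Rightarrow> bool" where
  "square_summable x \<longleftrightarrow> summable (\<lambda>n. (norm (x n))\<^sup>2)"

definition vector_functional ::
    "(nat \<Rightarrow> 'h) \<Rightarrow> (nat \<Rightarrow> 'h) \<Rightarrow> ('h::chilbert_space \<Rightarrow>\<^sub>L 'h) \<Rightarrow> complex" where
  "vector_functional x y a = (\<Sum>n. cinner (a (x n)) (y n))"

lemma normal_functionals_eq:
  "normal_functionals = {vector_functional x y | x y. square_summable x \<and> square_summable y}"
  unfolding normal_functionals_def vector_functional_def square_summable_def by blast

lemma summable_vector_functional: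
  assumes "square_summable x" "square_summable y"
  shows "summable (\<lambda>n. cinner (blinfun_apply a (x n)) (y n))"
proof (rule summable_comparison_test')
  show "summable (\<lambda>n. norm a * ((norm (x n))\<^sup>2 + (norm (y n))\<^sup>2))"
    using assms by (intro summable_mult summable_add) (auto simp: square_summable_def)
  fix n
  have "cmod (cinner (a (x n)) (y n)) \<le> norm (a (x n)) * norm (y n)" by (rule norm_cinner_le)
  also have "\<dots> \<le> (norm a * norm (x n)) * norm (y n)"
    by (intro mult_right_mono norm_blinfun) simp
  also have "\<dots> \<le> norm a * ((norm (x n))\<^sup>2 + (norm (y n))\<^sup>2)"
  proof -
    have "2 * (norm (x n) * norm (y n)) \<le> (norm (x n))\<^sup>2 + (norm (y n))\<^sup>2"
      using zero_le_power2[of "norm (x n) - norm (y n)"] by (simp add: power2_diff algebra_simps)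
    then have "norm (x n) * norm (y n) \<le> (norm (x n))\<^sup>2 + (norm (y n))\<^sup>2"
      using mult_nonneg_nonneg[OF norm_ge_zero[of "x n"] norm_ge_zero[of "y n"]] by linarith
    then show ?thesis by (simp add: mult.assoc mult_left_mono)
  qed
  finally show "norm (cinner (a (x n)) (y n)) \<le> norm a * ((norm (x n))\<^sup>2 + (norm (y n))\<^sup>2)" .
qed

text \<open>Transfers the Riesz norm bounds to whole sequences, since the square of a sum is at most
  twice the sum of the squares.\<close>

lemma square_summable_bound:
  assumes "square_summable x" "square_summable y" "\<And>n. norm (z n) \<le> C * (norm (x n) + norm (y n))"
  shows "square_summable z"
  unfolding square_summable_def
proof (rule summable_comparison_test')
  show "summable (\<lambda>n. 2 * C\<^sup>2 * ((norm (x n))\<^sup>2 + (norm (y n))\<^sup>2))"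
    using assms by (intro summable_mult summable_add) (auto simp: square_summable_def)
  fix n
  have "(norm (z n))\<^sup>2 \<le> (C * (norm (x n) + norm (y n)))\<^sup>2"
    by (intro power_mono assms) simp
  also have "\<dots> = C\<^sup>2 * (norm (x n) + norm (y n))\<^sup>2" by (simp add: power_mult_distrib)
  also have "\<dots> \<le> C\<^sup>2 * (2 * ((norm (x n))\<^sup>2 + (norm (y n))\<^sup>2))"
    using zero_le_power2[of "norm (x n) - norm (y n)"]
    by (intro mult_left_mono) (simp_all add: power2_diff power2_sum)
  finally show "norm ((norm (z n))\<^sup>2) \<le> 2 * C\<^sup>2 * ((norm (x n))\<^sup>2 + (norm (y n))\<^sup>2)"
    by (simp add: algebra_simps)
qed

lemma continuous_map_continuous_compose:
  assumes "continuous_on UNIV g" "continuous_map X euclidean f"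
  shows "continuous_map X euclidean (\<lambda>x. g (f x))"
  using continuous_map_compose[OF assms(2), of euclidean g] assms(1) by (simp add: o_def)

lemma continuous_map_vector_functional:
  assumes "square_summable x" "square_summable y"
  shows "continuous_map (weak_star_topology M) euclidean (vector_functional x y)"
proof (unfold continuous_map_alt, intro conjI allI impI)
  fix U :: "complex set" assume "openin euclidean U"
  then have "{a \<in> M. vector_functional x y a \<in> U}
      \<in> {{T \<in> M. \<phi> T \<in> U} | \<phi> U. \<phi> \<in> normal_functionals \<and> open U}"
    using assms by (auto simp: normal_functionals_eq)
  moreover have "vector_functional x y -` U \<inter> topspace (weak_star_topology M)
      = {a \<in> M. vector_functional x y a \<in> U}"
    by (auto simp: topspace_weak_star_topology)
  ultimately show "openin (weak_star_topology M) (vector_functional x y -` U \<inter> topspace (weak_star_topology M))"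
    by (simp add: weak_star_topology_def topology_generated_by_Basis)
qed simp

context vn_derivation
begin

text \<open>On \<open>sa\<close>, the real part of \<open>cinner (a p) q\<close> is its average with
  \<open>cinner (a q) p\<close>, which is its conjugate. This turns real functionals into complex
  linear ones, with \<open>y\<close> and \<open>\<i> *\<^sub>C y\<close> supplying real and
  imaginary parts; by linearity the identity passes from \<open>sa\<close> to
  \<open>M\<close>.\<close>

lemma cinner_representation:
  assumes v: "\<And>a. a \<in> sa \<Longrightarrow> d a x \<bullet> y = a x \<bullet> v + a y \<bullet> w"
    and v': "\<And>a. a \<in> sa \<Longrightarrow> d a x \<bullet> (\<i> *\<^sub>C y) = a x \<bullet> v' + a (\<i> *\<^sub>C y) \<bullet> w'"
    and "a \<in> M"
  shows "cinner (d a x) y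
    = (1/2) * (cinner (a x) v + cinner (a v) x + cinner (a y) w + cinner (a w) y)
      + (\<i>/2) * (cinner (a x) v' + cinner (a v') x + cinner (a (\<i> *\<^sub>C y)) w' + cinner (a w') (\<i> *\<^sub>C y))"
    (is "_ = ?F a")
proof -
  have re: "complex_of_real (a p \<bullet> q) = (1/2) * (cinner (a p) q + cinner (a q) p)" if "a \<in> sa" for a p q
  proof -
    have "cinner (a q) p = cnj (cinner (a p) q)"
      using sa_self_adjoint[OF that, of q p] cinner_commute[of q "a p"] by simp
    then show ?thesis by (simp add: complex_eq_iff inner_eq_Re_cinner)
  qed
  have eq: "cinner (d a x) y = ?F a" if a: "a \<in> sa" for a
  proof -
    have "cinner (d a x) y = complex_of_real (d a x \<bullet> y) + \<i> * complex_of_real (d a x \<bullet> (\<i> *\<^sub>C y))"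
      using Im_cinner[of "d a x" y] by (simp add: complex_eq_iff inner_eq_Re_cinner)
    also have "\<dots> = ?F a"
      unfolding v[OF a] v'[OF a] of_real_add re[OF a] by (simp add: algebra_simps)
    finally show ?thesis .
  qed
  obtain h k where hk: "h \<in> sa" "k \<in> sa" "a = h + scaleC_op \<i> k"
    using cartesian_decomposition[OF \<open>a \<in> M\<close>] by blast
  have "d a = d h + scaleC_op \<i> (d k)"
    using hk by (simp add: d_add d_scaleC sa_M M_intros)
  then have "cinner (d a x) y = ?F h + \<i> * ?F k"
    using eq[OF hk(1)] eq[OF hk(2)]
    by (simp only: blinfun.add_left cinner_add_left scaleC_op_apply cinner_scaleC_left)
  also have "\<dots> = ?F a"
    by (simp add: hk(3) blinfun.add_left cinner_add_left cinner_scaleC_left algebra_simps)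
  finally show ?thesis .
qed

lemma inner_representation_sequence:
  "\<exists>v w. \<forall>n::nat. norm (v n) \<le> K * (norm (x n) + norm (y n)) \<and> norm (w n) \<le> K * (norm (x n) + norm (y n))
    \<and> (\<forall>a\<in>sa. d a (x n) \<bullet> y n = a (x n) \<bullet> v n + a (y n) \<bullet> w n)"
proof -
  have "\<forall>n. \<exists>v w. norm v \<le> K * (norm (x n) + norm (y n)) \<and> norm w \<le> K * (norm (x n) + norm (y n))
    \<and> (\<forall>a\<in>sa. d a (x n) \<bullet> y n = a (x n) \<bullet> v + a (y n) \<bullet> w)"
    using inner_representation by blast
  from choice[OF this] obtain v where "\<forall>n. \<exists>w. norm (v n) \<le> K * (norm (x n) + norm (y n))
    \<and> norm w \<le> K * (norm (x n) + norm (y n))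
    \<and> (\<forall>a\<in>sa. d a (x n) \<bullet> y n = a (x n) \<bullet> v n + a (y n) \<bullet> w)" by blast
  from choice[OF this] show ?thesis by blast
qed

text \<open>Summing the identity for single vectors over \<open>n\<close> yields a combination of
  eight vector functionals, all of square-summable sequences.\<close>

lemma continuous_map_vector_functional_derivation:
  assumes x: "square_summable x" and y: "square_summable y"
  shows "continuous_map (weak_star_topology M) euclidean (\<lambda>a. vector_functional x y (d a))"
proof -
  define iy where "iy n = \<i> *\<^sub>C y n" for n
  have norm_iy: "norm (iy n) = norm (y n)" for n by (simp add: iy_def norm_scaleC)
  have iy: "square_summable iy" using y by (simp add: square_summable_def norm_iy)
  obtain v w where vw: "\<And>n. norm (v n) \<le> K * (norm (x n) + norm (y n))"
    "\<And>n. norm (w n) \<le> K * (norm (x n) + norm (y n))"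
    "\<And>n a. a \<in> sa \<Longrightarrow> d a (x n) \<bullet> y n = a (x n) \<bullet> v n + a (y n) \<bullet> w n"
    using inner_representation_sequence by metis
  obtain v' w' where vw': "\<And>n. norm (v' n) \<le> K * (norm (x n) + norm (iy n))"
    "\<And>n. norm (w' n) \<le> K * (norm (x n) + norm (iy n))"
    "\<And>n a. a \<in> sa \<Longrightarrow> d a (x n) \<bullet> iy n = a (x n) \<bullet> v' n + a (iy n) \<bullet> w' n"
    using inner_representation_sequence by metis
  have v: "square_summable v" and w: "square_summable w"
    by (rule square_summable_bound[OF x y]; fact)+
  have v': "square_summable v'" and w': "square_summable w'"
    by (rule square_summable_bound[OF x iy]; fact)+
  note ss = x y iy v w v' w'
  let ?F = "\<lambda>a. (1/2) * (vector_functional x v a + vector_functional v x a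
      + vector_functional y w a + vector_functional w y a)
    + (\<i>/2) * (vector_functional x v' a + vector_functional v' x a
      + vector_functional iy w' a + vector_functional w' iy a)"
  have "?F a = vector_functional x y (d a)" if "a \<in> M" for a
  proof -
    have sums: "(\<lambda>n. cinner (a (p n)) (q n)) sums vector_functional p q a"
      if "square_summable p" "square_summable q" for p q
      unfolding vector_functional_def by (rule summable_sums[OF summable_vector_functional[OF that]])
    have "(\<lambda>n. (1/2) * (cinner (a (x n)) (v n) + cinner (a (v n)) (x n)
          + cinner (a (y n)) (w n) + cinner (a (w n)) (y n))
        + (\<i>/2) * (cinner (a (x n)) (v' n) + cinner (a (v' n)) (x n)
          + cinner (a (iy n)) (w' n) + cinner (a (w' n)) (iy n))) sums ?F a"
      by (intro sums_add sums_mult sums ss)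
    moreover have "cinner (d a (x n)) (y n) = (1/2) * (cinner (a (x n)) (v n) + cinner (a (v n)) (x n)
          + cinner (a (y n)) (w n) + cinner (a (w n)) (y n))
        + (\<i>/2) * (cinner (a (x n)) (v' n) + cinner (a (v' n)) (x n)
          + cinner (a (iy n)) (w' n) + cinner (a (w' n)) (iy n))" for n
      unfolding iy_def by (rule cinner_representation[OF vw(3) vw'(3)[unfolded iy_def] that])
    ultimately show ?thesis
      unfolding vector_functional_def[of x y] by (simp add: sums_iff)
  qed
  moreover have "continuous_map (weak_star_topology M) euclidean ?F"
    by (intro continuous_map_add continuous_map_continuous_compose[where g = "\<lambda>z. c * z" for c :: complex]
        continuous_intros continuous_map_vector_functional ss)
  ultimately show ?thesis
    by (rule continuous_map_eq[rotated]) (simp_all add: topspace_weak_star_topology)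
qed

lemma weak_star_continuous: "continuous_map (weak_star_topology M) (weak_star_topology M) d"
proof -
  have "openin (weak_star_topology M) (d -` {a \<in> M. \<phi> a \<in> U} \<inter> M)"
    if "\<phi> \<in> normal_functionals" "open U" for \<phi> U
  proof -
    obtain x y where "\<phi> = vector_functional x y" "square_summable x" "square_summable y"
      using \<open>\<phi> \<in> normal_functionals\<close> by (auto simp: normal_functionals_eq)
    then have "openin (weak_star_topology M) {a \<in> topspace (weak_star_topology M). \<phi> (d a) \<in> U}"
      using openin_continuous_map_preimage[OF continuous_map_vector_functional_derivation] \<open>open U\<close> by simp
    moreover have "{a \<in> topspace (weak_star_topology M). \<phi> (d a) \<in> U} = d -` {a \<in> M. \<phi> a \<in> U} \<inter> M"
      using d_in by (auto simp: topspace_weak_star_topology)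
    ultimately show ?thesis by simp
  qed
  moreover have "d ` M \<subseteq> \<Union> {{a \<in> M. \<phi> a \<in> U} | \<phi> U. \<phi> \<in> normal_functionals \<and> open U}"
    using d_in topspace_weak_star_topology[of M]
    unfolding weak_star_topology_def topology_generated_by_topspace by blast
  \<comment> \<open>Only the target topology is unfolded, so that openness of preimages is checked
    on its generators.\<close>
  ultimately show ?thesis
    by (subst (2) weak_star_topology_def, unfold continuous_on_generated_topo_iff)
      (auto simp: topspace_weak_star_topology)
qed

end

section \<open>Localisation at a point\<close>

text \<open>Complete regularity separates \<open>t\<close> from the complement of a neighbourhood
  \<open>U\<close> lying in a compact \<open>C\<close>; reversing the separating function gives the
  bump.\<close>

lemma exists_compactly_supported_function:
  assumes "locally_compact_space L" "Hausdorff_space L" "t \<in> topspace L"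
  obtains f :: "'l \<Rightarrow> real" and C where "continuous_map L euclidean f" "f t = 1"
    "compactin L C" "\<And>s. s \<in> topspace L - C \<Longrightarrow> f s = 0"
proof -
  obtain U C where U: "openin L U" "compactin L C" "t \<in> U" "U \<subseteq> C"
    using assms(1,3) unfolding locally_compact_space_def by blast
  have "completely_regular_space L"
    using assms by (simp add: locally_compact_regular_imp_completely_regular_space)
  moreover have "closedin L (topspace L - U)" "t \<in> topspace L - (topspace L - U)"
    using U assms(3) by auto
  ultimately obtain g :: "'l \<Rightarrow> real" where g: "continuous_map L (top_of_set {0..1}) g" "g t = 0"
    "g ` (topspace L - U) \<subseteq> {1}"
    unfolding completely_regular_space_def by meson
  show ?thesis
  proof (rule that[of "\<lambda>s. 1 - g s" C])
    show "continuous_map L euclidean (\<lambda>s. 1 - g s)"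
      using g(1) by (intro continuous_intros) (auto simp: continuous_map_in_subtopology)
  qed (use g U in auto)
qed

lemma continuous_scaled_identity: "continuous_on UNIV (\<lambda>a::'a::real_normed_vector. sqrt (norm a) *\<^sub>R (b::'b::real_normed_vector))"
  by (intro continuous_intros)

text \<open>Only 0 is delicate: division by zero gives the value 0 there, and the norm of the value
  at \<open>a\<close> is \<open>sqrt (norm a)\<close>.\<close>

lemma continuous_square_root_part: "continuous_on UNIV (\<lambda>a::'a::real_normed_vector. (1 / sqrt (norm a)) *\<^sub>R a)"
proof (unfold continuous_on_eq_continuous_at[OF open_UNIV], intro ballI)
  fix a :: 'a
  show "isCont (\<lambda>a. (1 / sqrt (norm a)) *\<^sub>R a) a"
  proof (cases "a = 0")
    case True
    have "((\<lambda>a::'a. (1 / sqrt (norm a)) *\<^sub>R a) \<longlongrightarrow> 0) (at 0)"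
    proof (rule Lim_null_comparison)
      show "\<forall>\<^sub>F a::'a in at 0. norm ((1 / sqrt (norm a)) *\<^sub>R a) \<le> sqrt (norm a)"
        by (simp add: real_div_sqrt)
      have "((\<lambda>a::'a. sqrt (norm a)) \<longlongrightarrow> sqrt (norm (0::'a))) (at 0)"
        by (intro tendsto_intros)
      then show "((\<lambda>a::'a. sqrt (norm a)) \<longlongrightarrow> 0) (at 0)" by simp
    qed
    then show ?thesis by (simp add: True isCont_def)
  next
    case False
    then show ?thesis by (intro continuous_intros) auto
  qed
qed

section \<open>Constructing elements of \<open>C0 L M\<close>\<close>

context vn_algebra
begin

lemma C0_in: "X \<in> C0 L M \<Longrightarrow> s \<in> topspace L \<Longrightarrow> X s \<in> M"
  by (auto simp: C0_def)

lemma C0_I: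
  assumes "\<And>s. s \<in> topspace L \<Longrightarrow> X s \<in> M" "continuous_map L euclidean X"
    and "\<And>e. e > 0 \<Longrightarrow> \<exists>C. compactin L C \<and> (\<forall>s \<in> topspace L - C. norm (X s) < e)"
  shows "(\<lambda>s\<in>topspace L. X s) \<in> C0 L M"
  using assms continuous_map_eq[OF assms(2), of "\<lambda>s\<in>topspace L. X s"] by (auto simp: C0_def)

lemma C0_scaled_compact:
  assumes "a \<in> M" "continuous_map L euclidean f" "compactin L C"
    and "\<And>s. s \<in> topspace L - C \<Longrightarrow> f s = 0"
  shows "(\<lambda>s\<in>topspace L. f s *\<^sub>R a) \<in> C0 L M"
proof (rule C0_I)
  show "continuous_map L euclidean (\<lambda>s. f s *\<^sub>R a)"
    by (rule continuous_map_continuous_compose[OF _ assms(2)]) (intro continuous_intros)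
  show "\<exists>C. compactin L C \<and> (\<forall>s \<in> topspace L - C. norm (f s *\<^sub>R a) < e)" if "e > 0" for e
    using assms(3,4) that by (intro exI[of _ C]) simp
qed (simp add: M_intros assms)

lemma C0_continuous_image:
  assumes X: "X \<in> C0 L M" and g: "continuous_on UNIV g" "\<And>a. a \<in> M \<Longrightarrow> g a \<in> M"
    "\<And>a. norm (g a) \<le> sqrt (norm a)"
  shows "(\<lambda>s\<in>topspace L. g (X s)) \<in> C0 L M"
proof (rule C0_I)
  show "continuous_map L euclidean (\<lambda>s. g (X s))"
    using X by (intro continuous_map_continuous_compose[OF g(1)]) (simp add: C0_def)
  fix e :: real assume e: "e > 0"
  \<comment> \<open>The decay of \<open>X\<close> is requested at level \<open>e\<^sup>2\<close>
    because \<open>g\<close> is controlled by the square root of the norm.\<close>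
  then obtain C where "compactin L C" and C: "\<And>s. s \<in> topspace L - C \<Longrightarrow> norm (X s) < e\<^sup>2"
    using X zero_less_power[OF e, of 2] unfolding C0_def by blast
  moreover have "norm (g (X s)) < e" if "s \<in> topspace L - C" for s
  proof -
    have "sqrt (norm (X s)) < e"
      using real_sqrt_less_mono[OF C[OF that]] e by simp
    then show ?thesis using g(3)[of "X s"] by simp
  qed
  ultimately show "\<exists>C. compactin L C \<and> (\<forall>s \<in> topspace L - C. norm (g (X s)) < e)" by blast
qed (use C0_in[OF X] g(2) in blast)

text \<open>The difference is written with \<open>C0_add\<close> and \<open>C0_scale\<close>, the
  operations that a derivation is known to respect.\<close>

lemma C0_diff:
  assumes X: "X \<in> C0 L M" and Y: "Y \<in> C0 L M"
  shows "C0_add L X (C0_scale L (-1) Y) \<in> C0 L M" "C0_scale L (-1) Y \<in> C0 L M"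
proof -
  show scale: "C0_scale L (-1) Y \<in> C0 L M"
    unfolding C0_scale_def
  proof (rule C0_I)
    show "continuous_map L euclidean (\<lambda>s. scaleC_op (-1) (Y s))"
      unfolding scaleC_op_minus_one
      using Y by (intro continuous_map_continuous_compose[where g = uminus] continuous_intros) (simp add: C0_def)
  qed (use Y C0_in[OF Y] in \<open>auto simp: M_intros scaleC_op_minus_one C0_def\<close>)
  have sum: "C0_add L X Z \<in> C0 L M" if Z: "Z \<in> C0 L M" for Z
    unfolding C0_add_def
  proof (rule C0_I)
    show "continuous_map L euclidean (\<lambda>s. X s + Z s)"
      using X Z by (intro continuous_map_add) (simp_all add: C0_def)
    fix e :: real assume "e > 0"
    then have "e / 2 > 0" by simp
    obtain C1 where C1: "compactin L C1" "\<And>s. s \<in> topspace L - C1 \<Longrightarrow> norm (X s) < e / 2"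
      using X \<open>e / 2 > 0\<close> unfolding C0_def by blast
    obtain C2 where C2: "compactin L C2" "\<And>s. s \<in> topspace L - C2 \<Longrightarrow> norm (Z s) < e / 2"
      using Z \<open>e / 2 > 0\<close> unfolding C0_def by blast
    have "norm (X s + Z s) < e" if "s \<in> topspace L - (C1 \<union> C2)" for s
      using C1(2)[of s] C2(2)[of s] that norm_triangle_ineq[of "X s" "Z s"] by auto
    then show "\<exists>C. compactin L C \<and> (\<forall>s \<in> topspace L - C. norm (X s + Z s) < e)"
      using compactin_Un[OF C1(1) C2(1)] by blast
  qed (use C0_in[OF X] C0_in[OF Z] in \<open>auto simp: M_intros\<close>)
  show "C0_add L X (C0_scale L (-1) Y) \<in> C0 L M" by (rule sum[OF scale])
qed

end

section \<open>Locality of a derivation and the induced derivations on fibres\<close>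

locale C0_derivation_setting = vn_algebra M for M :: "('h::chilbert_space \<Rightarrow>\<^sub>L 'h) set" +
  fixes L :: "'l topology" and D :: "('l \<Rightarrow> 'h \<Rightarrow>\<^sub>L 'h) \<Rightarrow> 'l \<Rightarrow> 'h \<Rightarrow>\<^sub>L 'h"
  assumes D: "C0_derivation L M D"
begin

lemma D_in: "X \<in> C0 L M \<Longrightarrow> D X \<in> C0 L M"
  using D by (auto simp: C0_derivation_def)

lemma D_add: "X \<in> C0 L M \<Longrightarrow> Y \<in> C0 L M \<Longrightarrow> D (C0_add L X Y) = C0_add L (D X) (D Y)"
  using D by (auto simp: C0_derivation_def)

lemma D_scale: "X \<in> C0 L M \<Longrightarrow> D (C0_scale L c X) = C0_scale L c (D X)"
  using D by (auto simp: C0_derivation_def)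

lemma D_mult: "X \<in> C0 L M \<Longrightarrow> Y \<in> C0 L M \<Longrightarrow>
    D (C0_mult L X Y) = C0_add L (C0_mult L (D X) Y) (C0_mult L X (D Y))"
  using D by (auto simp: C0_derivation_def)

text \<open>
  An element vanishing at \<open>t\<close> factors as \<open>X = Y Z\<close> with \<open>Y = \<parallel>X\<parallel>\<^sup>1\<^sup>/\<^sup>2\<close> and \<open>Z = X / \<parallel>X\<parallel>\<^sup>1\<^sup>/\<^sup>2\<close>
  (which is \<open>0\<close> where \<open>X\<close> is) both vanishing at \<open>t\<close>.
\<close>

lemma D_vanishes:
  assumes X: "X \<in> C0 L M" and t: "t \<in> topspace L" and "X t = 0"
  shows "D X t = 0"
proof -
  define Y where "Y = (\<lambda>s\<in>topspace L. sqrt (norm (X s)) *\<^sub>R (id_blinfun :: 'h \<Rightarrow>\<^sub>L 'h))"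
  define Z where "Z = (\<lambda>s\<in>topspace L. (1 / sqrt (norm (X s))) *\<^sub>R X s)"
  have Y: "Y \<in> C0 L M"
    unfolding Y_def
  proof (rule C0_continuous_image[OF X, where g = "\<lambda>a. sqrt (norm a) *\<^sub>R id_blinfun"])
    show "norm (sqrt (norm a) *\<^sub>R (id_blinfun :: 'h \<Rightarrow>\<^sub>L 'h)) \<le> sqrt (norm a)" for a :: "'h \<Rightarrow>\<^sub>L 'h"
      using mult_left_mono[OF norm_blinfun_id_le, of "sqrt (norm a)"] by simp
  qed (auto simp: M_intros intro: continuous_scaled_identity)
  have Z: "Z \<in> C0 L M"
    unfolding Z_def
    by (rule C0_continuous_image[OF X, where g = "\<lambda>a. (1 / sqrt (norm a)) *\<^sub>R a"])
      (auto simp: M_intros real_div_sqrt intro: continuous_square_root_part)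
  have "X s = Y s o\<^sub>L Z s" if "s \<in> topspace L" for s
    using that by (cases "X s = 0") (simp_all add: Y_def Z_def blinfun_compose_linear)
  moreover have "X \<in> extensional (topspace L)" using X by (auto simp: C0_def PiE_iff)
  ultimately have "X = C0_mult L Y Z"
    by (auto simp: C0_mult_def fun_eq_iff extensional_def)
  then have "D X t = C0_add L (C0_mult L (D Y) Z) (C0_mult L Y (D Z)) t"
    by (simp only: D_mult[OF Y Z])
  then have "D X t = (D Y t o\<^sub>L Z t) + (Y t o\<^sub>L D Z t)"
    using t by (simp add: C0_add_def C0_mult_def)
  then show ?thesis using t \<open>X t = 0\<close> by (simp add: Y_def Z_def)
qed

lemma D_local:
  assumes X: "X \<in> C0 L M" and Y: "Y \<in> C0 L M" and t: "t \<in> topspace L" and "X t = Y t"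
  shows "D X t = D Y t"
proof -
  have "D (C0_add L X (C0_scale L (-1) Y)) t = 0"
    using t \<open>X t = Y t\<close>
    by (intro D_vanishes C0_diff X Y) (simp_all add: C0_add_def C0_scale_def scaleC_op_minus_one)
  then have "C0_add L (D X) (C0_scale L (-1) (D Y)) t = 0"
    by (simp only: D_add[OF X C0_diff(2)[OF X Y]] D_scale[OF Y])
  then show ?thesis
    using t by (simp add: C0_add_def C0_scale_def scaleC_op_minus_one)
qed

text \<open>Extend \<open>a\<close> to \<open>E a\<close> by a bump function equal to 1 at
  \<open>t\<close> and set \<open>d a = D (E a) t\<close>; by locality any other extension gives the
  same value.\<close>

lemma fibre_derivation:
  assumes L: "locally_compact_space L" "Hausdorff_space L" and t: "t \<in> topspace L"
  obtains d where "vn_derivation M d" "\<And>X. X \<in> C0 L M \<Longrightarrow> D X t = d (X t)"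
proof -
  obtain f C where f: "continuous_map L euclidean f" "f t = (1::real)"
    "compactin L C" "\<And>s. s \<in> topspace L - C \<Longrightarrow> f s = 0"
    using exists_compactly_supported_function[OF L t] by metis
  define E where "E a = (\<lambda>s\<in>topspace L. f s *\<^sub>R a)" for a :: "'h \<Rightarrow>\<^sub>L 'h"
  define d where "d a = D (E a) t" for a
  have E: "E a \<in> C0 L M" if "a \<in> M" for a
    unfolding E_def by (rule C0_scaled_compact[OF that f(1,3,4)])
  have Et: "E a t = a" for a using t f(2) by (simp add: E_def)
  have Dd: "D X t = d (X t)" if X: "X \<in> C0 L M" for X
    unfolding d_def by (rule D_local[OF X E[OF C0_in[OF X t]] t]) (simp add: Et)
  have "vn_derivation M d"
  proof unfold_locales
    fix a b c assume a: "a \<in> M"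
    show "d a \<in> M" unfolding d_def by (rule C0_in[OF D_in[OF E[OF a]] t])
    have "E (scaleC_op c a) = C0_scale L c (E a)"
      by (auto simp: E_def C0_scale_def scaleC_op_simps fun_eq_iff)
    then have "D (E (scaleC_op c a)) = C0_scale L c (D (E a))" by (simp only: D_scale[OF E[OF a]])
    then show "d (scaleC_op c a) = scaleC_op c (d a)"
      using t by (simp add: d_def C0_scale_def)
    assume b: "b \<in> M"
    have "E (a + b) = C0_add L (E a) (E b)"
      by (auto simp: E_def C0_add_def fun_eq_iff scaleR_add_right)
    then have "D (E (a + b)) = C0_add L (D (E a)) (D (E b))" by (simp only: D_add[OF E[OF a] E[OF b]])
    then show "d (a + b) = d a + d b"
      using t by (simp add: d_def C0_add_def)
    \<comment> \<open>This product carries the square of the bump, so it differs from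
      \<open>E (a o\<^sub>L b)\<close> in general; both equal \<open>a o\<^sub>L b\<close> at
      \<open>t\<close>, and locality does the rest.\<close>
    have "C0_mult L (E a) (E b) = (\<lambda>s\<in>topspace L. (f s * f s) *\<^sub>R (a o\<^sub>L b))"
      by (auto simp: E_def C0_mult_def fun_eq_iff blinfun_compose_linear)
    also have "\<dots> \<in> C0 L M"
      using f(4) by (intro C0_scaled_compact[OF compose_in[OF a b] _ f(3)] continuous_intros f(1)) simp
    finally have "d (C0_mult L (E a) (E b) t) = D (C0_mult L (E a) (E b)) t" by (rule Dd[symmetric])
    then have "d (C0_mult L (E a) (E b) t)
        = C0_add L (C0_mult L (D (E a)) (E b)) (C0_mult L (E a) (D (E b))) t"
      by (simp only: D_mult[OF E[OF a] E[OF b]])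
    then show "d (a o\<^sub>L b) = (d a o\<^sub>L b) + (a o\<^sub>L d b)"
      using t by (simp add: C0_mult_def C0_add_def Et d_def)
  qed
  with Dd that show ?thesis by blast
qed

end

theorem proposition3p7:
  fixes L :: "'l topology"
    and M :: "('h :: chilbert_space \<Rightarrow>\<^sub>L 'h) set"
    and D :: "('l \<Rightarrow> 'h \<Rightarrow>\<^sub>L 'h) \<Rightarrow> 'l \<Rightarrow> 'h \<Rightarrow>\<^sub>L 'h"
  assumes "von_neumann_algebra M"
    and "locally_compact_space L" and "Hausdorff_space L"
    and "C0_derivation L M D"
  shows "continuous_map (point_weak_star_topology L M) (point_weak_star_topology L M) D"
proof -
  interpret C0_derivation_setting M L D by unfold_locales (fact assms)+
  \<comment> \<open>The component at \<open>t\<close> is evaluation at \<open>t\<close> followed by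
    the weak* continuous derivation of the fibre.\<close>
  have "continuous_map (point_weak_star_topology L M) (weak_star_topology M) (\<lambda>X. D X t)"
    if t: "t \<in> topspace L" for t
  proof -
    obtain d where d: "vn_derivation M d" "\<And>X. X \<in> C0 L M \<Longrightarrow> D X t = d (X t)"
      using fibre_derivation[OF assms(2,3) t] by blast
    have "continuous_map (point_weak_star_topology L M) (weak_star_topology M) (\<lambda>X. X t)"
      unfolding point_weak_star_topology_def
      by (intro continuous_map_from_subtopology continuous_map_product_projection t)
    then have "continuous_map (point_weak_star_topology L M) (weak_star_topology M) (d \<circ> (\<lambda>X. X t))"
      using vn_derivation.weak_star_continuous[OF d(1)] by (rule continuous_map_compose)
    then show ?thesis
      by (rule continuous_map_eq) (simp add: topspace_point_weak_star_topology d(2))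
  qed
  \<comment> \<open>Points of the product topology are extensional functions, so componentwise
    continuity must be accompanied by this.\<close>
  moreover have "D X \<in> extensional (topspace L)" if "X \<in> C0 L M" for X
    using D_in[OF that] by (auto simp: C0_def PiE_iff)
  ultimately have "continuous_map (point_weak_star_topology L M)
      (product_topology (\<lambda>_. weak_star_topology M) (topspace L)) D"
    by (auto simp: continuous_map_componentwise topspace_point_weak_star_topology)
  then show ?thesis
    using D_in topspace_point_weak_star_topology[of L M]
    by (subst (2) point_weak_star_topology_def) (simp add: continuous_map_in_subtopology Pi_iff)
qed

end
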